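(* The sequence $\{p(n)\}$ satisfies $$\lim_{n\rightarrow\infty}\frac{p(n)}{\frac{1}{4n\sqrt{3}}\exp\left(\pi\sqrt{\frac{2n}{3}}\right)}=1.$$
   Context: For a positive integer $n$, $p(n)$ is the number of ways to express $n$ as a sum of positive integers (order of summands irrelevant). *)

theory Defs
  imports "HOL-Analysis.Analysis" "HOL-Library.Multiset"
begin

definition integer_partitions :: "nat \<Rightarrow> nat multiset set" where
  "integer_partitions n = {M. (\<forall>k\<in>#M. 0 < k) \<and> sum_mset M = n}"

definition partition_number :: "nat \<Rightarrow> nat" where
  "partition_number n = card (integer_partitions n)"

text \<open>Finiteness ensures that \<^const>\<open>card\<close> is a genuine count here.\<close>

lemma finite_integer_partitions: "finite (integer_partitions n)"
proof (rule finite_subset)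
  show "finite (mset ` {xs. set xs \<subseteq> {..n} \<and> length xs \<le> n})"
    by (intro finite_imageI finite_lists_length_le) simp
  show "integer_partitions n \<subseteq> mset ` {xs. set xs \<subseteq> {..n} \<and> length xs \<le> n}"
  proof
    fix M assume M: "M \<in> integer_partitions n"
    obtain xs where xs: "M = mset xs" by (metis ex_mset)
    have pos: "\<forall>k\<in>set xs. 0 < k" and total: "sum_list xs = n"
      using M by (auto simp: integer_partitions_def xs sum_mset_sum_list)
    have "length xs \<le> sum_list xs" using pos by (induction xs) auto
    moreover have "set xs \<subseteq> {..n}" using member_le_sum_list[of _ xs] total by auto
    ultimately show "M \<in> mset ` {xs. set xs \<subseteq> {..n} \<and> length xs \<le> n}"
      using xs total by blast
  qed
qed

end

theory Submission
  imports Defs "HOL-Probability.Sinc_Integral" "HOL-Real_Asymp.Real_Asymp"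
begin

text \<open>
  Write \<open>F s = (\<Sum>n. p n * exp (- n * s))\<close> for \<open>Re s > 0\<close>. The partition number is a Fourier
  coefficient of \<open>F\<close> on a vertical line,
  \<open>2 * pi * p n * exp (- n * t) = (\<integral>y\<in>{-pi..pi}. F (t + \<i> * y) * exp (\<i> * n * y))\<close>, and the proof is a
  saddle point evaluation of this integral at \<open>t = pi / sqrt (6 * n)\<close>.
  Taking logarithms in Euler's product and summing over the exponent of each factor gives
  \<open>F s = exp (\<Sum>m\<ge>1. 1 / (m * (exp (m * s) - 1)))\<close>, and everything rests on three consequences.

  First, close to the real axis. Split the Bose function as \<open>1 / (exp z - 1) = 1 / z + h z\<close>.
  The terms \<open>1 / z\<close> contribute
  \<open>pi\<^sup>2 / (6 * s)\<close> exactly. The derivative of \<open>h\<close> is \<open>O(1 / (1 + |z|\<^sup>2))\<close> in the sector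
  \<open>|Im z| \<le> Re z\<close> (\<open>bose_deriv_error_bound\<close>), so replacing \<open>s = t * (1 + \<i> * v)\<close> by \<open>t\<close> in the other
  terms costs only \<open>O(|v|)\<close>, uniformly in \<open>t\<close> (\<open>partition_gf_quotient\<close>). On the scale
  \<open>y = t powr (3/2) * u\<close>, where \<open>v = sqrt t * u\<close>, the integrand divided by \<open>F t\<close> therefore tends to
  \<open>exp (- pi\<^sup>2 * u\<^sup>2 / 6)\<close>; the choice of \<open>t\<close> cancels the linear term.

  Secondly, on the real axis: \<open>F t\<close> is asymptotic to \<open>sqrt (t / (2 * pi)) * exp (pi\<^sup>2 / (6 * t))\<close>
  (\<open>log_partition_gf_asymptotics\<close>). The constant \<open>1 / sqrt (2 * pi)\<close> is the delicate point. It is read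
  off from the product \<open>(\<Prod>k\<ge>1. 1 + 1 / (k * t)\<^sup>2) = sinh (pi / t) / (pi / t)\<close>, whose factors have the
  same logarithmic singularity in \<open>k * t\<close> as those of \<open>(F t)\<^sup>2\<close>. The logarithms of the quotients of
  the factors are values at \<open>k * t\<close> of a function that tends to \<open>0\<close> at \<open>0\<close> and whose second derivative
  is \<open>O(1 / (1 + x\<^sup>2))\<close>, and so their sum is \<open>c / t + o(1)\<close>; the value of \<open>c\<close> follows from the leading
  term of \<open>ln (F t)\<close>.

  Thirdly, far from the real axis: in \<open>|F (t + \<i> * y)| / F t\<close> the term \<open>m = 1\<close> alone
  (\<open>norm_partition_gf_le\<close>, \<open>bose_gap\<close>) already bounds the rescaled integrand by a constant times
  \<open>1 / (1 + u\<^sup>2)\<close>, so dominated convergence applies and the integral becomes a Gaussian one.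
\<close>

section \<open>Euler's product\<close>

definition bounded_partitions :: "nat \<Rightarrow> nat \<Rightarrow> nat multiset set" where
  "bounded_partitions N n = {M \<in> integer_partitions n. \<forall>k\<in>#M. k \<le> N}"

definition bounded_partition_number :: "nat \<Rightarrow> nat \<Rightarrow> nat" where
  "bounded_partition_number N n = card (bounded_partitions N n)"

lemma finite_bounded_partitions: "finite (bounded_partitions N n)"
  by (rule finite_subset[OF _ finite_integer_partitions[of n]]) (auto simp: bounded_partitions_def)

lemma bounded_partitions_0: "bounded_partitions 0 n = (if n = 0 then {{#}} else {})"
proof -
  have "M \<in> bounded_partitions 0 n \<longleftrightarrow> M = {#} \<and> n = 0" for M
  proof (cases "M = {#}")
    case False
    then obtain k where "k \<in># M" by auto
    then show ?thesis
      using False by (fastforce simp: bounded_partitions_def integer_partitions_def)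
  qed (auto simp: bounded_partitions_def integer_partitions_def)
  then show ?thesis by (simp add: set_eq_iff)
qed

lemma bounded_partitions_Suc:
  "bounded_partitions (Suc N) n = bounded_partitions N n \<union>
     (if Suc N \<le> n then add_mset (Suc N) ` bounded_partitions (Suc N) (n - Suc N) else {})"
proof (intro equalityI subsetI)
  fix M assume M: "M \<in> bounded_partitions (Suc N) n"
  show "M \<in> bounded_partitions N n \<union>
     (if Suc N \<le> n then add_mset (Suc N) ` bounded_partitions (Suc N) (n - Suc N) else {})"
  proof (cases "Suc N \<in># M")
    case True
    then obtain M' where M': "M = add_mset (Suc N) M'" by (meson mset_add)
    then have "Suc N \<le> n" "M' \<in> bounded_partitions (Suc N) (n - Suc N)"
      using M by (auto simp: bounded_partitions_def integer_partitions_def)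
    then show ?thesis using M' by auto
  next
    case False
    then have "M \<in> bounded_partitions N n"
      using M by (auto simp: bounded_partitions_def le_Suc_eq)
    then show ?thesis by simp
  qed
qed (auto simp: bounded_partitions_def integer_partitions_def split: if_splits)

lemma bounded_partition_number_Suc:
  "bounded_partition_number (Suc N) n = bounded_partition_number N n +
     (if Suc N \<le> n then bounded_partition_number (Suc N) (n - Suc N) else 0)"
proof (cases "Suc N \<le> n")
  case True
  have "bounded_partitions N n \<inter> add_mset (Suc N) ` bounded_partitions (Suc N) (n - Suc N) = {}"
    by (auto simp: bounded_partitions_def)
  moreover have "card (add_mset (Suc N) ` bounded_partitions (Suc N) (n - Suc N))
      = card (bounded_partitions (Suc N) (n - Suc N))"
    by (intro card_image inj_onI) auto
  ultimately show ?thesis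
    using True by (simp add: bounded_partition_number_def bounded_partitions_Suc[of N n]
        card_Un_disjoint finite_bounded_partitions)
next
  case False
  then show ?thesis
    using bounded_partitions_Suc[of N n] by (simp add: bounded_partition_number_def)
qed

lemma bounded_partition_number_le: "bounded_partition_number N n \<le> partition_number n"
  unfolding bounded_partition_number_def partition_number_def
  by (intro card_mono finite_integer_partitions) (auto simp: bounded_partitions_def)

lemma bounded_partition_number_eq:
  assumes "n \<le> N"
  shows "bounded_partition_number N n = partition_number n"
proof -
  have "k \<le> n" if "M \<in> integer_partitions n" "k \<in># M" for M k
    using that by (auto simp: integer_partitions_def sum_mset.remove)
  then have "bounded_partitions N n = integer_partitions n"
    using assms by (force simp: bounded_partitions_def)
  then show ?thesis
    by (simp add: bounded_partition_number_def partition_number_def)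
qed

text \<open>
  Multiplying the recurrence by \<open>q ^ n\<close> and truncating only loses nonnegative terms, so the partial
  sums \<open>S\<close> satisfy \<open>S (N + 1) \<le> S N + q ^ (N + 1) * S (N + 1)\<close>. This gives convergence before any
  identity between the series and the product is available.
\<close>

lemma sum_bounded_partition_number_le:
  fixes q :: real
  assumes "0 \<le> q" "q < 1"
  shows "(\<Sum>n<M. real (bounded_partition_number N n) * q ^ n) \<le> (\<Prod>k=1..N. 1 / (1 - q ^ k))"
proof (induction N)
  case 0
  have "(\<Sum>n<M. real (bounded_partition_number 0 n) * q ^ n) = (\<Sum>n<M. if n = 0 then 1 else 0)"
    by (intro sum.cong) (auto simp: bounded_partition_number_def bounded_partitions_0)
  then show ?case by simp
next
  case (Suc N)
  define b where "b = (\<lambda>N n. real (bounded_partition_number N n))"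
  let ?K = "Suc N" and ?S = "\<lambda>N. \<Sum>n<M. b N n * q ^ n"
  have "(\<Sum>n<M. if ?K \<le> n then b ?K (n - ?K) * q ^ n else 0)
      = (\<Sum>n\<in>{?K..<M}. b ?K (n - ?K) * q ^ n)"
    by (rule sum.mono_neutral_cong_right) auto
  also have "\<dots> = (\<Sum>i<M - ?K. q ^ ?K * (b ?K i * q ^ i))"
    by (rule sum.reindex_bij_witness[of _ "\<lambda>i. i + ?K" "\<lambda>n. n - ?K"])
       (auto simp flip: power_add power_Suc simp: mult_ac)
  also have "\<dots> \<le> (\<Sum>i<M. q ^ ?K * (b ?K i * q ^ i))"
    using assms by (intro sum_mono2) (auto simp: b_def)
  finally have *: "(\<Sum>n<M. if ?K \<le> n then b ?K (n - ?K) * q ^ n else 0) \<le> q ^ ?K * ?S ?K"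
    by (simp add: sum_distrib_left)
  have "?S ?K = ?S N + (\<Sum>n<M. if ?K \<le> n then b ?K (n - ?K) * q ^ n else 0)"
    unfolding sum.distrib[symmetric]
    by (intro sum.cong) (auto simp: b_def bounded_partition_number_Suc algebra_simps)
  with * have "(1 - q ^ ?K) * ?S ?K \<le> ?S N"
    by (simp add: algebra_simps)
  also have "\<dots> \<le> (\<Prod>k=1..N. 1 / (1 - q ^ k))"
    using Suc.IH by (simp add: b_def)
  finally have le: "(1 - q ^ ?K) * ?S ?K \<le> (\<Prod>k=1..N. 1 / (1 - q ^ k))" .
  have "0 < 1 - q ^ ?K"
    using assms power_decreasing[of 1 ?K q] by auto
  with le have "?S ?K \<le> (\<Prod>k=1..N. 1 / (1 - q ^ k)) / (1 - q ^ ?K)"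
    by (simp only: pos_le_divide_eq mult.commute)
  then show ?case
    by (simp add: b_def)
qed

lemma prod_inverse_one_minus_power_le:
  fixes q :: real
  assumes "0 \<le> q" "q < 1"
  shows "(\<Prod>k=1..N. 1 / (1 - q ^ k)) \<le> exp (1 / (1 - q)\<^sup>2)"
proof -
  have "1 / (1 - q ^ k) \<le> exp (q ^ k / (1 - q))" if "k \<in> {1..N}" for k
  proof -
    have qk: "q ^ k \<le> q" "0 \<le> q ^ k"
      using assms that power_decreasing[of 1 k q] by auto
    then have "q ^ k < 1" using assms by linarith
    have "1 / (1 - q ^ k) = 1 + q ^ k / (1 - q ^ k)"
      using \<open>q ^ k < 1\<close> by (simp add: field_simps)
    also have "\<dots> \<le> 1 + q ^ k / (1 - q)"
      using assms qk by (intro add_left_mono divide_left_mono) auto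
    also have "\<dots> \<le> exp (q ^ k / (1 - q))"
      by (rule exp_ge_add_one_self)
    finally show ?thesis .
  qed
  moreover have "q ^ k < 1" if "k \<in> {1..N}" for k
    using assms that power_decreasing[of 1 k q] by auto
  ultimately have "(\<Prod>k=1..N. 1 / (1 - q ^ k)) \<le> (\<Prod>k=1..N. exp (q ^ k / (1 - q)))"
    by (intro prod_mono) (auto simp: less_imp_le)
  also have "\<dots> = exp ((\<Sum>k=1..N. q ^ k) / (1 - q))"
    by (simp add: exp_sum sum_divide_distrib)
  also have "\<dots> \<le> exp (1 / (1 - q)\<^sup>2)"
  proof -
    have "(\<Sum>k=1..N. q ^ k) \<le> (\<Sum>k. q ^ k)"
      using assms by (intro sum_le_suminf summable_geometric) auto
    also have "\<dots> = 1 / (1 - q)"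
      using assms by (simp add: suminf_geometric)
    finally have "(\<Sum>k=1..N. q ^ k) / (1 - q) \<le> 1 / (1 - q) / (1 - q)"
      using assms by (intro divide_right_mono) auto
    then show ?thesis by (simp add: power2_eq_square)
  qed
  finally show ?thesis .
qed

text \<open>
  The first \<open>M\<close> coefficients do not change when the parts are restricted to be at most \<open>M\<close>, and the
  resulting bound does not depend on \<open>M\<close>.
\<close>

lemma summable_partition_number_real:
  fixes q :: real
  assumes "0 \<le> q" "q < 1"
  shows "summable (\<lambda>n. real (partition_number n) * q ^ n)"
proof (rule summableI_nonneg_bounded)
  fix M
  have "(\<Sum>n<M. real (partition_number n) * q ^ n)
      = (\<Sum>n<M. real (bounded_partition_number M n) * q ^ n)"
    by (intro sum.cong) (auto simp: bounded_partition_number_eq)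
  also have "\<dots> \<le> exp (1 / (1 - q)\<^sup>2)"
    using sum_bounded_partition_number_le[OF assms] prod_inverse_one_minus_power_le[OF assms]
    by (rule order_trans)
  finally show "(\<Sum>n<M. real (partition_number n) * q ^ n) \<le> exp (1 / (1 - q)\<^sup>2)" .
qed (use assms in auto)

lemma summable_norm_partition_number:
  fixes z :: complex
  assumes "norm z < 1"
  shows "summable (\<lambda>n. norm (of_nat (partition_number n) * z ^ n))"
  using summable_partition_number_real[of "norm z"] assms
  by (simp add: norm_mult norm_power)

lemma norm_power_Suc_less_one:
  fixes z :: complex
  assumes "norm z < 1"
  shows "norm (z ^ Suc k) < 1"
  using assms power_decreasing[of 1 "Suc k" "norm z"] by (simp add: norm_power del: power_Suc)

lemma bounded_partition_number_sums:
  fixes z :: complex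
  assumes "norm z < 1"
  shows "(\<lambda>n. of_nat (bounded_partition_number N n) * z ^ n) sums (\<Prod>k=1..N. 1 / (1 - z ^ k))"
proof (induction N)
  case 0
  have "(\<lambda>n. of_nat (bounded_partition_number 0 n) * z ^ n) = (\<lambda>n. if n = 0 then 1 else 0)"
    by (auto simp: bounded_partition_number_def bounded_partitions_0)
  then show ?case using sums_single[of 0 "\<lambda>_. 1::complex"] by simp
next
  case (Suc N)
  define b where "b = (\<lambda>N n. of_nat (bounded_partition_number N n) :: complex)"
  let ?K = "Suc N"
  have "summable (\<lambda>n. b ?K n * z ^ n)"
  proof (rule summable_comparison_test'[OF summable_norm_partition_number[OF assms]])
    show "norm (b ?K n * z ^ n) \<le> norm (of_nat (partition_number n) * z ^ n)" for n
      using bounded_partition_number_le[of ?K n] by (simp add: b_def norm_mult mult_right_mono)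
  qed
  then obtain S where S: "(\<lambda>n. b ?K n * z ^ n) sums S" by (auto simp: summable_def)
  \<comment> \<open>The recurrence turns into \<open>(1 - z ^ K) * S = \<close> the series for parts at most \<open>N\<close>.\<close>
  have "(\<lambda>n. z ^ ?K * (b ?K n * z ^ n)) sums (z ^ ?K * S)"
    by (rule sums_mult[OF S])
  also have "(\<lambda>n. z ^ ?K * (b ?K n * z ^ n)) =
      (\<lambda>n. (\<lambda>n. if ?K \<le> n then b ?K (n - ?K) * z ^ n else 0) (n + ?K))"
    by (auto simp: power_add mult_ac)
  finally have "(\<lambda>n. if ?K \<le> n then b ?K (n - ?K) * z ^ n else 0) sums (z ^ ?K * S)"
    by (subst (asm) sums_iff_shift) simp
  from sums_diff[OF S this] have "(\<lambda>n. b N n * z ^ n) sums (S - z ^ ?K * S)"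
    by (rule sums_cong[THEN iffD1, rotated])
       (auto simp: b_def bounded_partition_number_Suc[of N] algebra_simps)
  with Suc.IH have "S - z ^ ?K * S = (\<Prod>k=1..N. 1 / (1 - z ^ k))"
    by (simp add: b_def sums_unique2)
  moreover have "1 - z ^ ?K \<noteq> 0"
    using norm_power_Suc_less_one[OF assms, of N] by auto
  ultimately have "S = (\<Prod>k=1..N. 1 / (1 - z ^ k)) / (1 - z ^ ?K)"
    by (simp add: eq_divide_eq right_diff_distrib mult.commute del: power_Suc)
  then have "S = (\<Prod>k=1..?K. 1 / (1 - z ^ k))"
    by simp
  then show ?case using S by (simp add: b_def)
qed

text \<open>
  Coefficientwise the bounded partition numbers become stationary, and they are dominated by the
  summable unrestricted series; this is Tannery's theorem.
\<close>

lemma partition_number_euler_product: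
  fixes z :: complex
  assumes "norm z < 1"
  shows "(\<lambda>N. \<Prod>k=1..N. 1 / (1 - z ^ k)) \<longlonglongrightarrow> (\<Sum>n. of_nat (partition_number n) * z ^ n)"
proof -
  have "(\<lambda>N. \<Sum>n. of_nat (bounded_partition_number N n) * z ^ n)
      \<longlonglongrightarrow> (\<Sum>n. of_nat (partition_number n) * z ^ n)"
  proof (rule conjunct2[OF conjunct2[OF tannerys_theorem]])
    show "(\<lambda>N. of_nat (bounded_partition_number N n) * z ^ n)
        \<longlonglongrightarrow> of_nat (partition_number n) * z ^ n" for n
      by (rule tendsto_eventually)
         (auto simp: bounded_partition_number_eq intro!: eventually_mono[OF eventually_ge_at_top[of n]])
    show "\<forall>\<^sub>F (n, N) in sequentially \<times>\<^sub>F sequentially.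
        norm (of_nat (bounded_partition_number N n) * z ^ n)
          \<le> norm (of_nat (partition_number n) * z ^ n)"
      using bounded_partition_number_le
      by (intro always_eventually) (auto simp: norm_mult intro!: mult_right_mono)
  qed (use summable_norm_partition_number[OF assms] in auto)
  then show ?thesis
    using bounded_partition_number_sums[OF assms] by (simp add: sums_iff)
qed

text \<open>
  Each factor of the product is the exponential of a logarithmic series; interchanging the two
  summations leaves a geometric series over the parts. The interchange is done on finite products,
  followed by Tannery's theorem for the limit.
\<close>

lemma partition_number_eq_exp:
  fixes z :: complex
  assumes "norm z < 1"
  shows "(\<Sum>n. of_nat (partition_number n) * z ^ n)
       = exp (\<Sum>m. z ^ Suc m / (1 - z ^ Suc m) / of_nat (Suc m))"
proof -
  note small = norm_power_Suc_less_one[OF assms]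
  have factor: "1 / (1 - z ^ k) = exp (\<Sum>m. (z ^ Suc m) ^ k / of_nat (Suc m))"
    and summ: "summable (\<lambda>m. (z ^ Suc m) ^ k / of_nat (Suc m))" if "k \<ge> 1" for k
  proof -
    have "norm (z ^ k) < 1" using small[of "k - 1"] that by simp
    from Ln_series'[of "- (z ^ k)"] this
    have "(\<lambda>n. - ((z ^ k) ^ n) / of_nat n) sums Ln (1 - z ^ k)" by simp
    from sums_minus[OF this]
    have "(\<lambda>n. (z ^ k) ^ n / of_nat n) sums (- Ln (1 - z ^ k))" by simp
    then have "(\<lambda>m. (z ^ k) ^ Suc m / of_nat (Suc m)) sums (- Ln (1 - z ^ k))"
      by (subst sums_Suc_iff) simp
    also have "(\<lambda>m. (z ^ k) ^ Suc m / of_nat (Suc m)) = (\<lambda>m. (z ^ Suc m) ^ k / of_nat (Suc m))"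
      by (simp only: power_mult[symmetric] mult.commute)
    finally have s: "(\<lambda>m. (z ^ Suc m) ^ k / of_nat (Suc m)) sums (- Ln (1 - z ^ k))" .
    have "1 - z ^ k \<noteq> 0" using \<open>norm (z ^ k) < 1\<close> by auto
    then show "1 / (1 - z ^ k) = exp (\<Sum>m. (z ^ Suc m) ^ k / of_nat (Suc m))"
      using s by (simp add: sums_iff exp_minus field_simps)
    show "summable (\<lambda>m. (z ^ Suc m) ^ k / of_nat (Suc m))" using s by (rule sums_summable)
  qed
  have prod_eq: "(\<Prod>k=1..N. 1 / (1 - z ^ k))
      = exp (\<Sum>m. \<Sum>k=1..N. (z ^ Suc m) ^ k / of_nat (Suc m))" for N
  proof -
    have "(\<Prod>k=1..N. 1 / (1 - z ^ k)) = exp (\<Sum>k=1..N. \<Sum>m. (z ^ Suc m) ^ k / of_nat (Suc m))"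
      unfolding exp_sum[OF finite_atLeastAtMost] by (intro prod.cong refl factor) auto
    also have "(\<Sum>k=1..N. \<Sum>m. (z ^ Suc m) ^ k / of_nat (Suc m))
        = (\<Sum>m. \<Sum>k=1..N. (z ^ Suc m) ^ k / of_nat (Suc m))"
      by (rule suminf_sum[symmetric]) (use summ in auto)
    finally show ?thesis .
  qed
  have geo: "(\<Sum>k=1..N. w ^ k) = w * (1 - w ^ N) / (1 - w)" if "norm w < 1" for w :: complex and N
    using that sum_gp_offset[of w 1 "N - 1"] by (cases N) (auto simp: sum_gp field_simps)
  have "(\<lambda>N. \<Sum>m. \<Sum>k=1..N. (z ^ Suc m) ^ k / of_nat (Suc m))
      \<longlonglongrightarrow> (\<Sum>m. z ^ Suc m / (1 - z ^ Suc m) / of_nat (Suc m))"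
  proof (rule conjunct2[OF conjunct2[OF tannerys_theorem]])
    show "(\<lambda>N. \<Sum>k=1..N. (z ^ Suc m) ^ k / of_nat (Suc m))
        \<longlonglongrightarrow> z ^ Suc m / (1 - z ^ Suc m) / of_nat (Suc m)" for m
    proof -
      have "(\<lambda>N. z ^ Suc m * (1 - (z ^ Suc m) ^ N) / (1 - z ^ Suc m) / of_nat (Suc m))
          \<longlonglongrightarrow> z ^ Suc m * (1 - 0) / (1 - z ^ Suc m) / of_nat (Suc m)"
        by (intro tendsto_intros LIMSEQ_power_zero) (use small[of m] in \<open>auto simp del: of_nat_Suc\<close>)
      then show ?thesis
        unfolding sum_divide_distrib[symmetric] geo[OF small[of m]] by simp
    qed
    show "\<forall>\<^sub>F (m, N) in sequentially \<times>\<^sub>F sequentially.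
        norm (\<Sum>k=1..N. (z ^ Suc m) ^ k / of_nat (Suc m)) \<le> norm z ^ Suc m / (1 - norm z)"
    proof (intro always_eventually, clarify)
      fix m N :: nat
      define q where "q = norm z ^ Suc m"
      have q: "0 \<le> q" "q \<le> norm z" "q < 1"
        using assms power_decreasing[of 1 "Suc m" "norm z"]
        unfolding q_def by (simp_all del: power_Suc)
      have "norm (\<Sum>k=1..N. (z ^ Suc m) ^ k / of_nat (Suc m))
          = norm (\<Sum>k=1..N. (z ^ Suc m) ^ k) / of_nat (Suc m)"
        unfolding sum_divide_distrib[symmetric] norm_divide norm_of_nat ..
      also have "\<dots> \<le> norm (\<Sum>k=1..N. (z ^ Suc m) ^ k)"
        by (simp add: divide_le_eq mult_le_cancel_left1 del: power_Suc)
      also have "\<dots> \<le> (\<Sum>k=1..N. q ^ k)"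
        by (rule sum_norm_le) (simp add: q_def norm_power del: power_Suc)
      also have "\<dots> = q * (\<Sum>k<N. q ^ k)"
        unfolding sum_distrib_left
        by (rule sum.reindex_bij_witness[of _ Suc "\<lambda>k. k - 1"]) (auto simp flip: power_Suc)
      also have "\<dots> \<le> q * (\<Sum>k. q ^ k)"
        using q by (intro mult_left_mono sum_le_suminf summable_geometric) auto
      also have "\<dots> = q / (1 - q)"
        using q by (simp add: suminf_geometric)
      also have "\<dots> \<le> q / (1 - norm z)"
        using q assms by (auto intro!: divide_left_mono)
      finally show "norm (\<Sum>k=1..N. (z ^ Suc m) ^ k / of_nat (Suc m))
          \<le> norm z ^ Suc m / (1 - norm z)"
        by (simp add: q_def)
    qed
    show "summable (\<lambda>m. norm z ^ Suc m / (1 - norm z))"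
      using assms by (intro summable_divide) (simp add: summable_geometric summable_mult)
  qed auto
  then have "(\<lambda>N. exp (\<Sum>m. \<Sum>k=1..N. (z ^ Suc m) ^ k / of_nat (Suc m)))
      \<longlonglongrightarrow> exp (\<Sum>m. z ^ Suc m / (1 - z ^ Suc m) / of_nat (Suc m))"
    by (rule tendsto_exp)
  from LIMSEQ_unique[OF partition_number_euler_product[OF assms, unfolded prod_eq] this]
  show ?thesis .
qed

section \<open>The generating function near the positive real axis\<close>

definition partition_gf :: "complex \<Rightarrow> complex" where
  "partition_gf s = (\<Sum>n. of_nat (partition_number n) * exp (- s) ^ n)"

lemma norm_exp_minus_less_one: "Re s > 0 \<Longrightarrow> norm (exp (- s)) < 1"
  by simp

lemma exp_minus_power_quotient:
  fixes s :: complex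
  assumes "Re s > 0"
  shows "exp (- s) ^ Suc m / (1 - exp (- s) ^ Suc m) = 1 / (exp (of_nat (Suc m) * s) - 1)"
proof -
  have e: "exp (- s) ^ Suc m = 1 / exp (of_nat (Suc m) * s)"
    by (simp add: exp_of_nat_mult[symmetric] exp_minus field_simps flip: of_nat_Suc power_Suc)
  show ?thesis
    unfolding e by (simp add: divide_simps)
qed

lemma summable_partition_gf_exponent:
  fixes s :: complex
  assumes "Re s > 0"
  shows "summable (\<lambda>m. 1 / (exp (of_nat (Suc m) * s) - 1) / of_nat (Suc m))"
proof (rule summable_norm_cancel, rule summable_comparison_test')
  define q where "q = exp (- Re s)"
  have q: "0 < q" "q < 1" using assms by (auto simp: q_def)
  show "summable (\<lambda>m. q ^ Suc m / (1 - q))"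
    using q by (intro summable_divide) (simp add: summable_geometric summable_mult)
  show "norm (norm (1 / (exp (of_nat (Suc m) * s) - 1) / of_nat (Suc m))) \<le> q ^ Suc m / (1 - q)" for m
  proof -
    have qm: "q ^ Suc m \<le> q" using q power_decreasing[of 1 "Suc m" q] by simp
    have ns: "norm (exp (- s) ^ Suc m) = q ^ Suc m"
      by (simp add: norm_power q_def norm_mult)
    have "norm (1 / (exp (of_nat (Suc m) * s) - 1)) = q ^ Suc m / norm (1 - exp (- s) ^ Suc m)"
      unfolding exp_minus_power_quotient[OF assms, symmetric] norm_divide ns ..
    also have "\<dots> \<le> q ^ Suc m / (1 - q)"
    proof (intro divide_left_mono mult_pos_pos)
      have "1 - q \<le> 1 - norm (exp (- s) ^ Suc m)" using qm ns by simp
      also have "\<dots> \<le> norm (1 - exp (- s) ^ Suc m)"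
        using norm_triangle_ineq2[of 1 "exp (- s) ^ Suc m"] by simp
      finally show "1 - q \<le> norm (1 - exp (- s) ^ Suc m)" .
      then show "0 < norm (1 - exp (- s) ^ Suc m)" using q by linarith
    qed (use q in auto)
    finally have le: "norm (1 / (exp (of_nat (Suc m) * s) - 1)) \<le> q ^ Suc m / (1 - q)" .
    have "norm (1 / (exp (of_nat (Suc m) * s) - 1) / of_nat (Suc m))
        = norm (1 / (exp (of_nat (Suc m) * s) - 1)) / real (Suc m)"
      by (simp only: norm_divide norm_of_nat)
    also have "\<dots> \<le> norm (1 / (exp (of_nat (Suc m) * s) - 1)) / 1"
      by (intro divide_left_mono) auto
    finally show ?thesis using le by simp
  qed
qed

lemma partition_gf_eq_exp:
  assumes "Re s > 0"
  shows "partition_gf s = exp (\<Sum>m. 1 / (exp (of_nat (Suc m) * s) - 1) / of_nat (Suc m))"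
  unfolding partition_gf_def partition_number_eq_exp[OF norm_exp_minus_less_one[OF assms]]
    exp_minus_power_quotient[OF assms] ..

text \<open>
  This is \<open>x \<le> 2 * sinh (x / 2)\<close>, squared and multiplied by \<open>exp x\<close>.
\<close>

lemma exp_times_square_le:
  fixes x :: real
  assumes "0 \<le> x"
  shows "x\<^sup>2 * exp x \<le> (exp x - 1)\<^sup>2"
proof -
  have "x / 2 \<le> (exp (x / 2) - inverse (exp (x / 2))) / 2"
    using assms by (intro real_le_x_sinh) auto
  then have "x * exp (x / 2) \<le> (exp (x / 2) - inverse (exp (x / 2))) * exp (x / 2)"
    by (intro mult_right_mono) auto
  also have "\<dots> = exp x - 1"
    by (simp add: left_diff_distrib flip: exp_add)
  finally have "(x * exp (x / 2))\<^sup>2 \<le> (exp x - 1)\<^sup>2"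
    using assms by (intro power_mono) auto
  then show ?thesis
    by (simp add: power_mult_distrib flip: exp_double)
qed

lemma norm_exp_minus_one_ge:
  fixes z :: complex
  assumes "0 \<le> Re z"
  shows "exp (Re z) - 1 \<le> norm (exp z - 1)" "Re z \<le> norm (exp z - 1)"
proof -
  show *: "exp (Re z) - 1 \<le> norm (exp z - 1)"
    using norm_triangle_ineq2[of "exp z" 1] by simp
  have "Re z \<le> exp (Re z) - 1"
    using exp_ge_add_one_self[of "Re z"] by linarith
  with * show "Re z \<le> norm (exp z - 1)" by linarith
qed

lemma sector_norm:
  fixes z :: complex
  assumes "\<bar>Im z\<bar> \<le> Re z" "z \<noteq> 0"
  shows "0 < Re z" "(norm z)\<^sup>2 \<le> 2 * (Re z)\<^sup>2"
proof -
  show "0 < Re z"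
    using assms by (cases "Re z = 0") (auto simp: complex_eq_iff)
  then have "\<bar>Im z\<bar>\<^sup>2 \<le> (Re z)\<^sup>2"
    using assms by (intro power_mono) auto
  then show "(norm z)\<^sup>2 \<le> 2 * (Re z)\<^sup>2"
    by (simp add: cmod_power2)
qed

text \<open>
  The quantity estimated is the derivative of \<open>1 / (exp z - 1) - 1 / z\<close>. For \<open>|z| > 1\<close> both terms are
  separately \<open>O(1 / |z|\<^sup>2)\<close> in the sector. For \<open>|z| \<le> 1\<close> the poles cancel: over the common denominator
  the numerator is \<open>exp z * (exp z + exp (- z) - 2 - z\<^sup>2)\<close>, and its even Taylor expansion starts with
  \<open>z ^ 4\<close>, which is also the size of the denominator.
\<close>

lemma bose_deriv_error_bound:
  fixes z :: complex
  assumes "\<bar>Im z\<bar> \<le> Re z" "z \<noteq> 0"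
  shows "norm (1 / z\<^sup>2 - exp z / (exp z - 1)\<^sup>2) \<le> 12 / (1 + (norm z)\<^sup>2)"
proof -
  define x where "x = Re z"
  define r where "r = norm z"
  note sec = sector_norm[OF assms, folded x_def r_def]
  have x: "x > 0" and rx: "r\<^sup>2 \<le> 2 * x\<^sup>2" using sec by auto
  have r: "r > 0" using assms by (auto simp: r_def)
  have e1: "exp x - 1 \<le> norm (exp z - 1)" "x \<le> norm (exp z - 1)"
    using norm_exp_minus_one_ge[of z] x by (auto simp: x_def)
  have ne: "exp z - 1 \<noteq> 0" using e1 x by auto
  show ?thesis
  proof (cases "r \<le> 1")
    case False
    have "norm (exp z / (exp z - 1)\<^sup>2) = exp x / (norm (exp z - 1))\<^sup>2"
      by (simp add: norm_divide norm_power x_def)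
    also have "\<dots> \<le> exp x / (exp x - 1)\<^sup>2"
      using e1 x ne by (intro divide_left_mono power_mono mult_pos_pos) auto
    also have "\<dots> \<le> 1 / x\<^sup>2"
      using exp_times_square_le[of x] x by (simp add: divide_simps mult.commute)
    also have "\<dots> \<le> 2 / r\<^sup>2"
      using rx x r by (simp add: divide_simps)
    finally have "norm (exp z / (exp z - 1)\<^sup>2) \<le> 2 / r\<^sup>2" .
    moreover have "norm (1 / z\<^sup>2) = 1 / r\<^sup>2"
      by (simp add: norm_divide norm_power r_def)
    ultimately have "norm (1 / z\<^sup>2 - exp z / (exp z - 1)\<^sup>2) \<le> 1 / r\<^sup>2 + 2 / r\<^sup>2"
      using norm_triangle_ineq4[of "1 / z\<^sup>2" "exp z / (exp z - 1)\<^sup>2"] by linarith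
    also have "\<dots> = 3 / r\<^sup>2"
      by (simp add: field_simps)
    also have "\<dots> \<le> 12 / (1 + r\<^sup>2)"
    proof -
      have "1 \<le> r\<^sup>2" using False by (simp add: one_le_power)
      then have "3 * (1 + r\<^sup>2) \<le> 12 * r\<^sup>2" by simp
      then show ?thesis using r by (simp add: divide_simps add_pos_pos)
    qed
    finally show ?thesis by (simp add: r_def)
  next
    case True
    have x1: "x \<le> 1" using True complex_Re_le_cmod[of z] by (simp add: x_def r_def)
    let ?T = "\<lambda>z::complex. \<Sum>k\<le>3. z ^ k / fact k"
    have T: "norm (exp w - ?T w) \<le> exp x * r ^ 4 / 6" if "w = z \<or> w = - z" for w
      using Taylor_exp[of w 3] that x by (auto simp: x_def r_def fact_numeral)
    have "(exp z - 1)\<^sup>2 - z\<^sup>2 * exp z = exp z * ((exp z - ?T z) + (exp (- z) - ?T (- z)))"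
      by (simp add: numeral_3_eq_3 fact_numeral power2_eq_square algebra_simps flip: exp_add)
    then have "norm ((exp z - 1)\<^sup>2 - z\<^sup>2 * exp z)
        = exp x * norm ((exp z - ?T z) + (exp (- z) - ?T (- z)))"
      by (simp add: norm_mult x_def)
    also have "\<dots> \<le> exp x * (exp x * r ^ 4 / 6 + exp x * r ^ 4 / 6)"
      using T[of z] T[of "- z"] by (intro mult_left_mono norm_triangle_le add_mono) auto
    also have "\<dots> = (exp x)\<^sup>2 * (r ^ 4 / 3)"
      by (simp add: power2_eq_square field_simps)
    also have "\<dots> \<le> 3\<^sup>2 * (r ^ 4 / 3)"
    proof (intro mult_right_mono power_mono)
      show "exp x \<le> 3" using exp_le x1 by (meson exp_le_cancel_iff order_trans)
    qed auto
    finally have num: "norm ((exp z - 1)\<^sup>2 - z\<^sup>2 * exp z) \<le> 3 * r ^ 4"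
      by simp
    have "r ^ 4 / 2 = r\<^sup>2 * (r\<^sup>2 / 2)"
      by (simp add: power_add[symmetric])
    also have "\<dots> \<le> r\<^sup>2 * x\<^sup>2"
      using rx by (intro mult_left_mono) auto
    also have "\<dots> \<le> r\<^sup>2 * (norm (exp z - 1))\<^sup>2"
      using e1 x by (intro mult_left_mono power_mono) auto
    finally have den: "r ^ 4 / 2 \<le> norm (z\<^sup>2 * (exp z - 1)\<^sup>2)"
      by (simp add: norm_mult norm_power r_def)
    have "1 / z\<^sup>2 - exp z / (exp z - 1)\<^sup>2 = ((exp z - 1)\<^sup>2 - z\<^sup>2 * exp z) / (z\<^sup>2 * (exp z - 1)\<^sup>2)"
      using assms(2) ne by (simp add: divide_simps)
    then have "norm (1 / z\<^sup>2 - exp z / (exp z - 1)\<^sup>2)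
        = norm ((exp z - 1)\<^sup>2 - z\<^sup>2 * exp z) / norm (z\<^sup>2 * (exp z - 1)\<^sup>2)"
      by (simp only: norm_divide)
    also have "\<dots> \<le> (3 * r ^ 4) / (r ^ 4 / 2)"
      using num den r by (intro frac_le) auto
    also have "\<dots> = 6" using r by simp
    also have "\<dots> \<le> 12 / (1 + r\<^sup>2)"
    proof -
      have "r\<^sup>2 \<le> 1" using True r by (simp add: power_le_one)
      then have "6 * (1 + r\<^sup>2) \<le> 12" by simp
      then show ?thesis by (simp add: pos_le_divide_eq add_pos_nonneg)
    qed
    finally show ?thesis by (simp add: r_def)
  qed
qed

text \<open>
  Comparison with the integral of \<open>1 / (1 + x\<^sup>2)\<close>, in the form of a telescoping sum of arctangents.
\<close>

lemma
  fixes t :: real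
  assumes "0 < t"
  shows summable_inverse_one_plus_square: "summable (\<lambda>m. 1 / (1 + (real (Suc m) * t)\<^sup>2))"
    and suminf_inverse_one_plus_square_le: "(\<Sum>m. 1 / (1 + (real (Suc m) * t)\<^sup>2)) \<le> pi / (2 * t)"
proof -
  have step: "1 / (1 + (real (Suc m) * t)\<^sup>2)
      \<le> (arctan (real (Suc m) * t) - arctan (real m * t)) / t" for m
  proof -
    have "\<exists>w>real m * t. w < real (Suc m) * t \<and>
        arctan (real (Suc m) * t) - arctan (real m * t)
        = (real (Suc m) * t - real m * t) * inverse (1 + w\<^sup>2)"
      using assms by (intro MVT2 DERIV_arctan) auto
    then obtain w where w: "real m * t < w" "w < real (Suc m) * t"
      "arctan (real (Suc m) * t) - arctan (real m * t) = t * inverse (1 + w\<^sup>2)"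
      by (auto simp: algebra_simps)
    have "0 \<le> w" using w(1) assms by (meson less_imp_le mult_nonneg_nonneg of_nat_0_le_iff order_trans)
    then have "w\<^sup>2 \<le> (real (Suc m) * t)\<^sup>2" using w(2) by (intro power_mono) auto
    then have "1 / (1 + (real (Suc m) * t)\<^sup>2) \<le> 1 / (1 + w\<^sup>2)"
      by (intro divide_left_mono) (auto intro!: mult_pos_pos add_pos_nonneg)
    also have "\<dots> = (arctan (real (Suc m) * t) - arctan (real m * t)) / t"
      unfolding w(3) using assms by (simp add: inverse_eq_divide)
    finally show ?thesis .
  qed
  have bound: "(\<Sum>m<M. 1 / (1 + (real (Suc m) * t)\<^sup>2)) \<le> pi / (2 * t)" for M
  proof -
    have "(\<Sum>m<M. 1 / (1 + (real (Suc m) * t)\<^sup>2))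
        \<le> (\<Sum>m<M. (arctan (real (Suc m) * t) - arctan (real m * t)) / t)"
      by (intro sum_mono step)
    also have "\<dots> = arctan (real M * t) / t"
      using sum_lessThan_telescope[of "\<lambda>m. arctan (real m * t)" M]
      unfolding sum_divide_distrib[symmetric] by simp
    also have "\<dots> \<le> (pi / 2) / t"
      using assms arctan_ubound[of "real M * t"] by (intro divide_right_mono) auto
    finally show ?thesis by simp
  qed
  show s: "summable (\<lambda>m. 1 / (1 + (real (Suc m) * t)\<^sup>2))"
    by (rule summableI_nonneg_bounded[OF _ bound]) (simp add: add_pos_nonneg less_imp_le)
  show "(\<Sum>m. 1 / (1 + (real (Suc m) * t)\<^sup>2)) \<le> pi / (2 * t)"
    by (rule suminf_le_const[OF s bound])
qed

lemma bose_error_lipschitz: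
  fixes s :: complex and t :: real
  assumes "0 < t" "Re s = t" "\<bar>Im s\<bar> \<le> t"
  shows "norm ((1 / (exp s - 1) - 1 / s) - (1 / (exp (of_real t) - 1) - 1 / of_real t)) \<le> 12 / (1 + t\<^sup>2) * \<bar>Im s\<bar>"
proof -
  have seg: "Re z = t \<and> \<bar>Im z\<bar> \<le> t" if z: "z \<in> closed_segment (of_real t) s" for z
  proof -
    obtain u where u: "0 \<le> u" "u \<le> 1" "z = (1 - u) *\<^sub>R of_real t + u *\<^sub>R s"
      using z unfolding closed_segment_def by blast
    have "Re z = t" "Im z = u * Im s" unfolding u(3) using assms by (simp_all add: algebra_simps)
    moreover have "\<bar>u * Im s\<bar> \<le> 1 * t"
      unfolding abs_mult using u assms by (intro mult_mono) auto
    ultimately show ?thesis by simp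
  qed
  have "norm ((1 / (exp s - 1) - 1 / s) - (1 / (exp (of_real t) - 1) - 1 / of_real t))
      \<le> 12 / (1 + t\<^sup>2) * norm (s - of_real t)"
  proof (rule field_differentiable_bound[of "closed_segment (of_real t) s" _
        "\<lambda>z. 1 / z\<^sup>2 - exp z / (exp z - 1)\<^sup>2"])
    fix z :: complex assume z: "z \<in> closed_segment (of_real t) s"
    note rz = seg[OF z]
    have z0: "z \<noteq> 0" using rz assms by auto
    have ne: "exp z - 1 \<noteq> 0"
      using norm_exp_minus_one_ge(2)[of z] rz assms by auto
    show "((\<lambda>z. 1 / (exp z - 1) - 1 / z) has_field_derivative
        (1 / z\<^sup>2 - exp z / (exp z - 1)\<^sup>2)) (at z within closed_segment (of_real t) s)"
      using z0 ne by (auto intro!: derivative_eq_intros simp: power2_eq_square)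
    have "norm (1 / z\<^sup>2 - exp z / (exp z - 1)\<^sup>2) \<le> 12 / (1 + (norm z)\<^sup>2)"
      using rz z0 by (intro bose_deriv_error_bound) auto
    also have "\<dots> \<le> 12 / (1 + t\<^sup>2)"
      using rz by (intro divide_left_mono) (auto simp: cmod_power2 intro!: mult_pos_pos add_pos_nonneg)
    finally show "norm (1 / z\<^sup>2 - exp z / (exp z - 1)\<^sup>2) \<le> 12 / (1 + t\<^sup>2)" .
  qed auto
  moreover have "norm (s - of_real t) = \<bar>Im s\<bar>"
    using assms by (simp add: cmod_def)
  ultimately show ?thesis by simp
qed

text \<open>
  The local form of the generating function around the real point \<open>t\<close>. In the exponent, the principal
  parts \<open>1 / (m\<^sup>2 * s)\<close> sum to \<open>pi\<^sup>2 / (6 * s)\<close>; the remaining parts change by at most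
  \<open>12 * t * |v| / (1 + (m * t)\<^sup>2)\<close> for each \<open>m\<close>, and the sum over \<open>m\<close> gains a factor \<open>1 / t\<close> that cancels
  the length of the displacement.
\<close>

lemma partition_gf_quotient:
  fixes t v :: real
  assumes "0 < t" "\<bar>v\<bar> \<le> 1"
  obtains E where "norm E \<le> 6 * pi * \<bar>v\<bar>"
    "partition_gf (t * (1 + \<i> * v)) =
       partition_gf t * exp (pi\<^sup>2 / (6 * t) * (1 / (1 + \<i> * v) - 1) + E)"
proof -
  define s where "s = t * (1 + \<i> * v)"
  define a where "a = (\<lambda>(z::complex) m. 1 / (exp (of_nat (Suc m) * z) - 1) / of_nat (Suc m))"
  define b where "b = (\<lambda>m. complex_of_real (1 / (real m + 1)\<^sup>2) * (1 / s - 1 / t))"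
  define g where "g = (\<lambda>m. a s m - a t m - b m)"
  have s: "Re s = t" "Im s = t * v" by (auto simp: s_def)
  have s0: "s \<noteq> 0" using s assms by auto
  have sa: "summable (a s)" "summable (a t)"
    using summable_partition_gf_exponent[of s] summable_partition_gf_exponent[of "of_real t"] s assms
    unfolding a_def by simp_all
  have sb: "b sums (pi\<^sup>2 / 6 * (1 / s - 1 / t))"
    unfolding b_def using sums_mult2[OF sums_of_real[OF inverse_squares_sums, where ?'a = complex]]
    by (simp add: add.commute)
  have gb: "norm (g m) \<le> 12 * t * \<bar>v\<bar> * (1 / (1 + (real (Suc m) * t)\<^sup>2))" for m
  proof -
    define k where "k = Suc m"
    have k: "k > 0" by (simp add: k_def)
    \<comment> \<open>What remains of a difference of two terms once the principal parts are taken out is a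
      difference of two values of \<open>1 / (exp z - 1) - 1 / z\<close>, which is Lipschitz.\<close>
    have cancel: "A / c - B / c - 1 / c\<^sup>2 * (1 / s - 1 / w) = ((A - 1 / (c * s)) - (B - 1 / (c * w))) / c"
      if "c \<noteq> 0" "w \<noteq> 0" for A B c w :: complex
      using that s0 by (simp add: field_simps power2_eq_square)
    have "g m = 1 / (exp (of_nat k * s) - 1) / of_nat k
        - 1 / (exp (of_nat k * of_real t) - 1) / of_nat k - 1 / (of_nat k)\<^sup>2 * (1 / s - 1 / of_real t)"
      unfolding g_def a_def b_def by (simp add: k_def add.commute)
    also have "\<dots> = ((1 / (exp (of_nat k * s) - 1) - 1 / (of_nat k * s))
        - (1 / (exp (of_real (real k * t)) - 1) - 1 / of_real (real k * t))) / of_nat k"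
      using k assms by (subst cancel) simp_all
    finally have "norm (g m) = norm ((1 / (exp (of_nat k * s) - 1) - 1 / (of_nat k * s))
        - (1 / (exp (of_real (real k * t)) - 1) - 1 / of_real (real k * t))) / real k"
      by (simp only: norm_divide norm_of_nat)
    also have "\<dots> \<le> (12 / (1 + (real k * t)\<^sup>2) * \<bar>Im (of_nat k * s)\<bar>) / real k"
      using assms s k by (intro divide_right_mono bose_error_lipschitz)
        (auto simp: abs_mult mult_left_le)
    also have "\<dots> = 12 * t * \<bar>v\<bar> * (1 / (1 + (real k * t)\<^sup>2))"
      using assms s k by (simp add: abs_mult)
    finally show ?thesis by (simp only: k_def)
  qed
  note sq = summable_inverse_one_plus_square[OF assms(1)]
  have sng: "summable (\<lambda>m. norm (g m))"
    by (rule summable_comparison_test'[OF summable_mult[OF sq]]) (use gb in auto)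
  have "norm (suminf g) \<le> (\<Sum>m. norm (g m))"
    by (rule summable_norm[OF sng])
  also have "\<dots> \<le> (\<Sum>m. 12 * t * \<bar>v\<bar> * (1 / (1 + (real (Suc m) * t)\<^sup>2)))"
    by (intro suminf_le gb sng summable_mult sq)
  also have "\<dots> = 12 * t * \<bar>v\<bar> * (\<Sum>m. 1 / (1 + (real (Suc m) * t)\<^sup>2))"
    by (rule suminf_mult[OF sq])
  also have "\<dots> \<le> 12 * t * \<bar>v\<bar> * (pi / (2 * t))"
    using assms by (intro mult_left_mono suminf_inverse_one_plus_square_le) auto
  also have "\<dots> = 6 * pi * \<bar>v\<bar>" using assms by simp
  finally have E: "norm (suminf g) \<le> 6 * pi * \<bar>v\<bar>" .
  have "g sums (suminf (a s) - suminf (a t) - pi\<^sup>2 / 6 * (1 / s - 1 / t))"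
    unfolding g_def using sa sb by (intro sums_diff) auto
  then have "suminf (a s) = suminf (a t) + (pi\<^sup>2 / 6 * (1 / s - 1 / t) + suminf g)"
    by (simp add: sums_iff)
  also have "pi\<^sup>2 / 6 * (1 / s - 1 / t) = pi\<^sup>2 / (6 * t) * (1 / (1 + \<i> * v) - 1)"
    using assms by (simp add: s_def right_diff_distrib)
  finally have "partition_gf s = partition_gf t * exp (pi\<^sup>2 / (6 * t) * (1 / (1 + \<i> * v) - 1) + suminf g)"
    using partition_gf_eq_exp[of s] partition_gf_eq_exp[of t] s assms
    unfolding a_def by (simp add: exp_add del: of_nat_Suc)
  with E show ?thesis using that s_def by blast
qed

section \<open>The generating function on the positive real axis\<close>

definition log_partition_gf :: "real \<Rightarrow> real" where
  "log_partition_gf t = (\<Sum>m. 1 / (exp (real (Suc m) * t) - 1) / real (Suc m))"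

lemma partition_gf_of_real:
  assumes "t > 0"
  shows "partition_gf (of_real t) = of_real (exp (log_partition_gf t))"
proof -
  have "summable (\<lambda>m. complex_of_real (1 / (exp (real (Suc m) * t) - 1) / real (Suc m)))"
    using summable_partition_gf_exponent[of "of_real t"] assms by (simp flip: exp_of_real)
  then have s: "summable (\<lambda>m. 1 / (exp (real (Suc m) * t) - 1) / real (Suc m))"
    by (simp only: summable_complex_of_real)
  have "partition_gf (of_real t)
      = exp (\<Sum>m. complex_of_real (1 / (exp (real (Suc m) * t) - 1) / real (Suc m)))"
    using partition_gf_eq_exp[of "of_real t"] assms by (simp flip: exp_of_real)
  also have "\<dots> = exp (of_real (log_partition_gf t))"
    unfolding log_partition_gf_def suminf_of_real[OF s] ..
  finally show ?thesis by (simp add: exp_of_real)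
qed

lemma log_partition_gf_product:
  assumes "t > 0"
  shows "(\<lambda>N. \<Prod>k=1..N. 1 / (1 - exp (- (real k * t)))) \<longlonglongrightarrow> exp (log_partition_gf t)"
proof -
  have "norm (exp (- complex_of_real t)) < 1"
    using assms by simp
  from partition_number_euler_product[OF this]
  have "(\<lambda>N. \<Prod>k=1..N. 1 / (1 - exp (- complex_of_real t) ^ k)) \<longlonglongrightarrow> of_real (exp (log_partition_gf t))"
    using partition_gf_of_real[OF assms] by (simp add: partition_gf_def)
  also have "(\<lambda>N. \<Prod>k=1..N. 1 / (1 - exp (- complex_of_real t) ^ k))
      = (\<lambda>N. of_real (\<Prod>k=1..N. 1 / (1 - exp (- (real k * t)))))"
    by (simp add: exp_of_nat_mult[symmetric] flip: exp_of_real)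
  finally show ?thesis by (simp only: tendsto_of_real_iff)
qed

lemma sinh_product_formula:
  assumes "t > (0::real)"
  shows "(\<lambda>N. \<Prod>k=1..N. 1 + 1 / (real k * t)\<^sup>2) \<longlonglongrightarrow> sinh (pi / t) / (pi / t)"
proof -
  \<comment> \<open>The sine product at an imaginary argument.\<close>
  define z where "z = \<i> / complex_of_real t"
  have "(\<lambda>n. of_real pi * z * (\<Prod>k=1..n. 1 - z\<^sup>2 / of_nat k ^ 2) / (of_real pi * z))
      \<longlonglongrightarrow> sin (of_real pi * z) / (of_real pi * z)"
    using assms by (intro tendsto_divide sin_product_formula_complex tendsto_const) (auto simp: z_def)
  also have "(\<lambda>n. of_real pi * z * (\<Prod>k=1..n. 1 - z\<^sup>2 / of_nat k ^ 2) / (of_real pi * z))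
      = (\<lambda>n. of_real (\<Prod>k=1..n. 1 + 1 / (real k * t)\<^sup>2))"
    using assms by (auto simp: z_def power_divide power_mult_distrib mult.commute)
  also have "sin (of_real pi * z) = \<i> * of_real (sinh (pi / t))"
  proof -
    have sinh_real: "sinh (complex_of_real y) = of_real (sinh y)" for y
      by (simp add: sinh_field_def exp_of_real flip: of_real_minus)
    have "\<i> * (of_real pi * z) = - of_real (pi / t)"
      using assms by (simp add: z_def field_simps)
    then show ?thesis
      unfolding sin_conv_sinh by (simp add: sinh_real del: of_real_divide)
  qed
  also have "\<i> * of_real (sinh (pi / t)) / (of_real pi * z) = of_real (sinh (pi / t) / (pi / t))"
    using assms by (simp add: z_def)
  finally show ?thesis by (simp only: tendsto_of_real_iff)
qed

text \<open>
  The logarithm of a factor of the product for \<open>sinh (pi / t) / (pi / t)\<close> divided by the square of a factor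
  \<open>1 / (1 - exp (- k * t))\<close> of the generating function, at \<open>x = k * t\<close>. The singularities \<open>- 2 * ln x\<close> at \<open>0\<close>
  cancel.
\<close>

definition log_comparison :: "real \<Rightarrow> real" where
  "log_comparison x = ln (1 + 1 / x\<^sup>2) + 2 * ln (1 - exp (- x))"

lemma log_comparison_sums:
  assumes "t > 0"
  shows "(\<lambda>k. log_comparison (real (Suc k) * t)) sums
           (ln (sinh (pi / t) / (pi / t)) - 2 * log_partition_gf t)"
proof -
  let ?A = "\<lambda>N. \<Prod>k=1..N. 1 + 1 / (real k * t)\<^sup>2"
  let ?B = "\<lambda>N. \<Prod>k=1..N. 1 / (1 - exp (- (real k * t)))"
  have pos: "sinh (pi / t) / (pi / t) > 0"
    using assms by simp
  have part: "(\<Sum>k<N. log_comparison (real (Suc k) * t)) = ln (?A N) - 2 * ln (?B N)" for N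
  proof -
    have A: "ln (?A N) = (\<Sum>k=1..N. ln (1 + 1 / (real k * t)\<^sup>2))"
      using assms by (intro ln_prod) (auto simp: add_nonneg_eq_0_iff)
    have "ln (?B N) = (\<Sum>k=1..N. ln (1 / (1 - exp (- (real k * t)))))"
      using assms by (intro ln_prod) auto
    also have "\<dots> = (\<Sum>k=1..N. - ln (1 - exp (- (real k * t))))"
      using assms by (intro sum.cong refl) (simp add: ln_div)
    finally have B: "ln (?B N) = - (\<Sum>k=1..N. ln (1 - exp (- (real k * t))))"
      by (simp add: sum_negf)
    have "(\<Sum>k<N. log_comparison (real (Suc k) * t)) = (\<Sum>k=1..N. log_comparison (real k * t))"
      by (rule sum.reindex_bij_witness[of _ "\<lambda>k. k - 1" Suc]) auto
    then show ?thesis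
      unfolding A B log_comparison_def by (simp add: sum.distrib sum_distrib_left)
  qed
  have "(\<lambda>N. ln (?A N) - 2 * ln (?B N)) \<longlonglongrightarrow>
      ln (sinh (pi / t) / (pi / t)) - 2 * ln (exp (log_partition_gf t))"
    using pos by (intro tendsto_intros sinh_product_formula log_partition_gf_product assms) auto
  then show ?thesis
    unfolding sums_def part by simp
qed

lemma second_difference_bound:
  fixes f f' f'' :: "real \<Rightarrow> real"
  assumes "0 < t"
    and f': "\<And>x. a \<le> x \<Longrightarrow> x \<le> a + 2 * t \<Longrightarrow> (f has_real_derivative f' x) (at x)"
    and f'': "\<And>x. a \<le> x \<Longrightarrow> x \<le> a + 2 * t \<Longrightarrow> (f' has_real_derivative f'' x) (at x)"
    and B: "\<And>x. a \<le> x \<Longrightarrow> x \<le> a + 2 * t \<Longrightarrow> \<bar>f'' x\<bar> \<le> B"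
  shows "\<bar>f a - 2 * f (a + t) + f (a + 2 * t)\<bar> \<le> t\<^sup>2 * B"
proof -
  have "\<exists>x>a. x < a + t \<and> (f (a + t + t) - f (a + t)) - (f (a + t) - f a)
      = (a + t - a) * (f' (x + t) - f' x)"
  proof (rule MVT2[of a "a + t" "\<lambda>x. f (x + t) - f x" "\<lambda>x. f' (x + t) - f' x"])
    fix x assume x: "a \<le> x" "x \<le> a + t"
    have "((\<lambda>x. f (x + t)) has_real_derivative f' (x + t)) (at x)"
      using f'[of "x + t"] x assms(1) by (simp add: DERIV_shift)
    moreover have "(f has_real_derivative f' x) (at x)"
      using x assms(1) by (intro f') auto
    ultimately show "((\<lambda>x. f (x + t) - f x) has_real_derivative f' (x + t) - f' x) (at x)"
      by (rule DERIV_diff)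
  qed (use assms in auto)
  then obtain x where x: "a < x" "x < a + t"
    "f (a + t + t) - f (a + t) - (f (a + t) - f a) = t * (f' (x + t) - f' x)" by auto
  have "\<exists>y>x. y < x + t \<and> f' (x + t) - f' x = (x + t - x) * f'' y"
    using x assms(1) by (intro MVT2 f'') auto
  then obtain y where y: "x < y" "y < x + t" "f' (x + t) - f' x = t * f'' y" by auto
  have "f a - 2 * f (a + t) + f (a + 2 * t) = t\<^sup>2 * f'' y"
    using x(3) y(3) by (simp add: power2_eq_square algebra_simps)
  moreover have "\<bar>f'' y\<bar> \<le> B" using x y by (intro B) auto
  ultimately show ?thesis by (simp add: abs_mult mult_left_mono)
qed

text \<open>
  Up to the derivative of \<open>x / (1 + x\<^sup>2)\<close>, half of the second derivative is the quantity bounded in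
  \<open>bose_deriv_error_bound\<close>, at a real argument.
\<close>

lemma log_comparison_second_difference:
  assumes "0 < a" "0 < t"
  shows "\<bar>log_comparison a - 2 * log_comparison (a + t) + log_comparison (a + 2 * t)\<bar>
           \<le> t\<^sup>2 * (26 / (1 + a\<^sup>2))"
proof (rule second_difference_bound[where f' = "\<lambda>x. 2 / (exp x - 1) - 2 / x + 2 * x / (1 + x\<^sup>2)"
      and f'' = "\<lambda>x. 2 * (1 / x\<^sup>2 - exp x / (exp x - 1)\<^sup>2) + 2 * (1 - x\<^sup>2) / (1 + x\<^sup>2)\<^sup>2"])
  fix x assume x: "a \<le> x" "x \<le> a + 2 * t"
  have x0: "x > 0" using x assms by simp
  have ne: "exp x - 1 \<noteq> 0" "1 + x\<^sup>2 \<noteq> 0" "1 - exp (- x) > 0" "1 + 1 / x\<^sup>2 > 0"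
    using x0 by (auto simp: add_pos_nonneg add_nonneg_eq_0_iff)
  have "((\<lambda>x. 1 + 1 / x\<^sup>2) has_real_derivative - 2 / x ^ 3) (at x)"
    using x0 by (auto intro!: derivative_eq_intros simp: power2_eq_square power3_eq_cube field_simps)
  from DERIV_chain2[OF DERIV_ln_divide[OF ne(4)] this]
  have "((\<lambda>x. ln (1 + 1 / x\<^sup>2)) has_real_derivative (- 2 / x ^ 3) / (1 + 1 / x\<^sup>2)) (at x)"
    by (simp add: mult.commute)
  moreover have "((\<lambda>x. 2 * ln (1 - exp (- x))) has_real_derivative
      2 * (exp (- x) / (1 - exp (- x)))) (at x)"
    using ne by (auto intro!: derivative_eq_intros)
  ultimately have "(log_comparison has_real_derivative
      (- 2 / x ^ 3) / (1 + 1 / x\<^sup>2) + 2 * (exp (- x) / (1 - exp (- x)))) (at x)"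
    unfolding log_comparison_def[abs_def] by (rule DERIV_add)
  also have "(- 2 / x ^ 3) / (1 + 1 / x\<^sup>2) = - 2 / x + 2 * x / (1 + x\<^sup>2)"
    using x0 ne by (simp add: divide_simps) (simp add: power2_eq_square power3_eq_cube algebra_simps)
  also have "exp (- x) / (1 - exp (- x)) = 1 / (exp x - 1)"
    using x0 ne by (simp add: exp_minus field_simps)
  finally show "(log_comparison has_real_derivative
      2 / (exp x - 1) - 2 / x + 2 * x / (1 + x\<^sup>2)) (at x)"
    by (simp add: algebra_simps)
  show "((\<lambda>x. 2 / (exp x - 1) - 2 / x + 2 * x / (1 + x\<^sup>2)) has_real_derivative
      2 * (1 / x\<^sup>2 - exp x / (exp x - 1)\<^sup>2) + 2 * (1 - x\<^sup>2) / (1 + x\<^sup>2)\<^sup>2) (at x)"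
    using x0 ne by (auto intro!: derivative_eq_intros simp: power2_eq_square)
      (simp add: divide_simps; simp add: algebra_simps)?
  have "1 / (complex_of_real x)\<^sup>2 - exp (of_real x) / (exp (of_real x) - 1)\<^sup>2
      = of_real (1 / x\<^sup>2 - exp x / (exp x - 1)\<^sup>2)"
    by (simp flip: exp_of_real)
  then have "\<bar>1 / x\<^sup>2 - exp x / (exp x - 1)\<^sup>2\<bar> \<le> 12 / (1 + x\<^sup>2)"
    using bose_deriv_error_bound[of "of_real x"] x0 by (simp only: norm_of_real) simp
  moreover have "\<bar>2 * (1 - x\<^sup>2) / (1 + x\<^sup>2)\<^sup>2\<bar> \<le> 2 / (1 + x\<^sup>2)"
  proof -
    have cancel: "2 * c / c\<^sup>2 = 2 / c" if "c \<noteq> 0" for c :: real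
      using that by (simp add: power2_eq_square)
    have "\<bar>2 * (1 - x\<^sup>2)\<bar> \<le> 2 * (1 + x\<^sup>2)"
      by (simp add: abs_le_iff)
    from divide_right_mono[OF this, of "(1 + x\<^sup>2)\<^sup>2"] show ?thesis
      unfolding cancel[OF ne(2)] abs_divide by simp
  qed
  moreover have "\<bar>2 * A + B\<bar> \<le> 2 * p + q" if "\<bar>A\<bar> \<le> p" "\<bar>B\<bar> \<le> q" for A B p q :: real
    using that by linarith
  ultimately have "\<bar>2 * (1 / x\<^sup>2 - exp x / (exp x - 1)\<^sup>2) + 2 * (1 - x\<^sup>2) / (1 + x\<^sup>2)\<^sup>2\<bar>
      \<le> 2 * (12 / (1 + x\<^sup>2)) + 2 / (1 + x\<^sup>2)"
    by blast
  also have "\<dots> = 26 / (1 + x\<^sup>2)"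
    by (simp add: field_simps)
  also have "\<dots> \<le> 26 / (1 + a\<^sup>2)"
    using x assms by (intro divide_left_mono add_left_mono power_mono mult_pos_pos add_pos_nonneg) auto
  finally show "\<bar>2 * (1 / x\<^sup>2 - exp x / (exp x - 1)\<^sup>2) + 2 * (1 - x\<^sup>2) / (1 + x\<^sup>2)\<^sup>2\<bar>
      \<le> 26 / (1 + a\<^sup>2)" .
qed (use assms in auto)

definition log_comparison_sum :: "real \<Rightarrow> real" where
  "log_comparison_sum t = (\<Sum>k. log_comparison (real (Suc k) * t))"

text \<open>
  The difference is the alternating sum of the values at \<open>t\<close>, \<open>2 * t\<close>, \<open>3 * t\<close>, \<open>\<dots>\<close>. Each pair
  \<open>d a - d (a + t)\<close> is half of the second difference at \<open>a\<close> plus half of \<open>d a - d (a + 2 * t)\<close>. The latter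
  telescope to \<open>d t / 2\<close>, and the former are \<open>O(t\<^sup>2 / (1 + a\<^sup>2))\<close>, with sum \<open>O(t)\<close>.
\<close>

lemma log_comparison_sum_halving:
  assumes "0 < t"
  shows "\<bar>log_comparison_sum t - 2 * log_comparison_sum (2 * t)\<bar> \<le> \<bar>log_comparison t\<bar> / 2 + 13 * pi / 2 * t"
proof -
  define d where "d = log_comparison"
  define \<Delta> where "\<Delta> = (\<lambda>j. d (real (2*j+1) * t) - 2 * d (real (2*j+2) * t) + d (real (2*j+3) * t))"
  have s: "(\<lambda>k. d (real (Suc k) * u)) sums log_comparison_sum u" if "u > 0" for u
    using log_comparison_sums[OF that] by (simp add: d_def log_comparison_sum_def sums_iff)
  have "(\<lambda>j. \<Sum>k=j*2..<j*2+2. d (real (Suc k) * t)) sums log_comparison_sum t"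
    using s[OF assms] by (rule sums_group) auto
  also have "(\<lambda>j. \<Sum>k=j*2..<j*2+2. d (real (Suc k) * t))
      = (\<lambda>j. d (real (2*j+1) * t) + d (real (2*j+2) * t))"
    by (auto simp: numeral_2_eq_2 mult.commute)
  finally have pairs: "(\<lambda>j. d (real (2*j+1) * t) + d (real (2*j+2) * t)) sums log_comparison_sum t" .
  have "(\<lambda>j. 2 * d (real (Suc j) * (2 * t))) sums (2 * log_comparison_sum (2 * t))"
    using assms by (intro sums_mult s) auto
  also have "(\<lambda>j. 2 * d (real (Suc j) * (2 * t))) = (\<lambda>j. 2 * d (real (2*j+2) * t))"
    by (simp add: algebra_simps)
  finally have alternating: "(\<lambda>j. d (real (2*j+1) * t) - d (real (2*j+2) * t)) sums
      (log_comparison_sum t - 2 * log_comparison_sum (2 * t))"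
    using sums_diff[OF pairs] by fastforce
  have lim: "(\<lambda>j. d (real (2*j+1) * t)) \<longlonglongrightarrow> 0"
  proof -
    have "(\<lambda>k. d (real (Suc k) * t)) \<longlonglongrightarrow> 0"
      using s[OF assms] by (intro summable_LIMSEQ_zero) (rule sums_summable)
    from LIMSEQ_subseq_LIMSEQ[OF this, of "\<lambda>j. 2 * j"] show ?thesis
      by (simp add: strict_mono_def o_def)
  qed
  have "(\<lambda>j. d (real (2*j+1) * t) - d (real (2*Suc j+1) * t)) sums (d (real (2*0+1) * t) - 0)"
    by (rule telescope_sums'[OF lim])
  then have tele: "(\<lambda>j. (d (real (2*j+1) * t) - d (real (2*j+3) * t)) / 2) sums (d t / 2)"
    by (intro sums_divide) (simp add: numeral_3_eq_3)
  from sums_diff[OF alternating tele]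
  have \<Delta>: "(\<lambda>j. \<Delta> j / 2) sums (log_comparison_sum t - 2 * log_comparison_sum (2 * t) - d t / 2)"
    by (simp add: \<Delta>_def field_simps)
  have \<Delta>_le: "\<bar>\<Delta> j / 2\<bar> \<le> 13 * t\<^sup>2 * (1 / (1 + (real (Suc j) * t)\<^sup>2))" for j
  proof -
    define a where "a = real (2*j+1) * t"
    have a: "a > 0" using assms by (simp add: a_def)
    have "\<Delta> j = d a - 2 * d (a + t) + d (a + 2 * t)"
      unfolding \<Delta>_def a_def by (simp add: algebra_simps)
    then have "\<bar>\<Delta> j\<bar> \<le> t\<^sup>2 * (26 / (1 + a\<^sup>2))"
      using log_comparison_second_difference[OF a assms] by (simp add: d_def)
    also have "\<dots> \<le> t\<^sup>2 * (26 / (1 + (real (Suc j) * t)\<^sup>2))"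
      using assms unfolding a_def
      by (intro mult_left_mono divide_left_mono add_left_mono power_mono mult_right_mono
          mult_pos_pos add_pos_nonneg) auto
    finally show ?thesis by (simp add: mult.commute)
  qed
  note sq = summable_inverse_one_plus_square[OF assms]
  have sn: "summable (\<lambda>j. \<bar>\<Delta> j / 2\<bar>)"
    by (rule summable_comparison_test'[OF summable_mult[OF sq, of "13 * t\<^sup>2"]])
       (simp only: real_norm_def abs_abs \<Delta>_le)
  have "\<bar>\<Sum>j. \<Delta> j / 2\<bar> \<le> (\<Sum>j. \<bar>\<Delta> j / 2\<bar>)"
    by (rule summable_rabs[OF sn])
  also have "\<dots> \<le> (\<Sum>j. 13 * t\<^sup>2 * (1 / (1 + (real (Suc j) * t)\<^sup>2)))"
    by (intro suminf_le \<Delta>_le sn summable_mult sq)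
  also have "\<dots> = 13 * t\<^sup>2 * (\<Sum>j. 1 / (1 + (real (Suc j) * t)\<^sup>2))"
    by (rule suminf_mult[OF sq])
  also have "\<dots> \<le> 13 * t\<^sup>2 * (pi / (2 * t))"
    using assms by (intro mult_left_mono suminf_inverse_one_plus_square_le) auto
  also have "\<dots> = 13 * pi / 2 * t"
    using assms by (simp add: power2_eq_square)
  finally have "\<bar>log_comparison_sum t - 2 * log_comparison_sum (2 * t) - d t / 2\<bar> \<le> 13 * pi / 2 * t"
    using \<Delta> by (simp add: sums_iff)
  then show ?thesis unfolding d_def by linarith
qed

lemma tendsto_log_comparison_0: "(log_comparison \<longlongrightarrow> 0) (at_right 0)"
  unfolding log_comparison_def[abs_def] by real_asymp

lemma tendsto_times_log_partition_gf:
  "((\<lambda>t. t * log_partition_gf t) \<longlongrightarrow> pi\<^sup>2 / 6) (at_right 0)"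
proof -
  let ?a = "\<lambda>m t. t * (1 / (exp (real (Suc m) * t) - 1) / real (Suc m))"
  have squares: "(\<lambda>m. 1 / (real m + 1)\<^sup>2) sums (pi\<^sup>2 / 6)"
    using inverse_squares_sums by (simp add: add.commute)
  have bound: "norm (?a m t) \<le> 1 / (real m + 1)\<^sup>2" if "t > 0" for m and t :: real
  proof -
    define k where "k = real (Suc m)"
    have k: "k > 0" by (simp add: k_def)
    have "k * t \<le> exp (k * t) - 1" using exp_ge_add_one_self[of "k * t"] by linarith
    moreover have "k * t > 0" using k that by simp
    ultimately have "1 / (exp (k * t) - 1) \<le> 1 / (k * t)" "0 < exp (k * t) - 1"
      by (auto intro!: divide_left_mono mult_pos_pos)
    then have "t * (1 / (exp (k * t) - 1) / k) \<le> t * (1 / (k * t) / k)"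
      using k that by (intro mult_left_mono divide_right_mono) auto
    moreover have "0 \<le> t * (1 / (exp (k * t) - 1) / k)"
      using \<open>0 < exp (k * t) - 1\<close> k that by simp
    moreover have "t * (1 / (k * t) / k) = 1 / (real m + 1)\<^sup>2"
      using k that by (simp add: k_def power2_eq_square add.commute)
    ultimately show ?thesis unfolding k_def by (simp only: real_norm_def abs_of_nonneg)
  qed
  have T: "((\<lambda>t. \<Sum>m. ?a m t) \<longlongrightarrow> (\<Sum>m. 1 / (real m + 1)\<^sup>2)) (at_right 0)"
  proof (rule conjunct2[OF conjunct2[OF tannerys_theorem]])
    show "((\<lambda>t. ?a m t) \<longlongrightarrow> 1 / (real m + 1)\<^sup>2) (at_right 0)" for m
    proof -
      define k where "k = real (Suc m)"
      have "k > 0" by (simp add: k_def)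
      then have "((\<lambda>t. t * (1 / (exp (k * t) - 1) / k)) \<longlongrightarrow> inverse k * inverse k) (at_right 0)"
        by real_asymp
      then show ?thesis by (simp add: k_def add.commute power2_eq_square divide_inverse)
    qed
    show "\<forall>\<^sub>F (m, t) in sequentially \<times>\<^sub>F at_right 0. norm (?a m t) \<le> 1 / (real m + 1)\<^sup>2"
    proof (rule eventually_mono)
      show "\<forall>\<^sub>F (m, t) in sequentially \<times>\<^sub>F at_right 0. (0::real) < t"
        by (simp add: eventually_prod2 eventually_at_right_less)
    qed (use bound in \<open>auto simp del: of_nat_Suc\<close>)
    show "summable (\<lambda>m. 1 / (real m + 1)\<^sup>2)"
      using squares by (rule sums_summable)
  qed auto
  have "(\<Sum>m. ?a m t) = t * log_partition_gf t" if "t > 0" for t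
  proof -
    have "summable (\<lambda>m. 1 / (real m + 1)\<^sup>2 / t)"
      using sums_summable[OF squares] by (rule summable_divide)
    then have "summable (\<lambda>m. 1 / (exp (real (Suc m) * t) - 1) / real (Suc m))"
    proof (rule summable_comparison_test')
      show "norm (1 / (exp (real (Suc m) * t) - 1) / real (Suc m)) \<le> 1 / (real m + 1)\<^sup>2 / t" for m
        using bound[OF that, of m] that unfolding norm_mult by (simp add: pos_le_divide_eq mult.commute)
    qed
    then show ?thesis unfolding log_partition_gf_def by (rule suminf_mult)
  qed
  then have "\<forall>\<^sub>F t in at_right 0. (\<Sum>m. ?a m t) = t * log_partition_gf t"
    using eventually_at_right_less[of "0::real"] by (auto elim: eventually_mono)
  from tendsto_cong[THEN iffD1, OF this T] show ?thesis
    unfolding sums_unique[OF squares, symmetric] .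
qed

text \<open>
  Only the leading order of the generating function enters here; \<open>tendsto_log_comparison_sum\<close> upgrades
  it to an expansion with error \<open>o(1)\<close>.
\<close>

lemma tendsto_times_log_comparison_sum:
  "((\<lambda>t. t * log_comparison_sum t) \<longlongrightarrow> pi - pi\<^sup>2 / 3) (at_right 0)"
proof -
  have "((\<lambda>t. t * ln (sinh (pi / t) / (pi / t))) \<longlongrightarrow> pi) (at_right 0)"
    unfolding sinh_field_def by real_asymp
  from tendsto_diff[OF this tendsto_mult_left[OF tendsto_times_log_partition_gf, of 2]]
  have "((\<lambda>t. t * ln (sinh (pi / t) / (pi / t)) - 2 * (t * log_partition_gf t)) \<longlongrightarrow> pi - pi\<^sup>2 / 3) (at_right 0)"
    by simp
  moreover have "\<forall>\<^sub>F t in at_right 0.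
      t * ln (sinh (pi / t) / (pi / t)) - 2 * (t * log_partition_gf t) = t * log_comparison_sum t"
    using eventually_at_right_less[of "0::real"]
  proof (rule eventually_mono)
    fix t :: real assume "0 < t"
    then have "log_comparison_sum t = ln (sinh (pi / t) / (pi / t)) - 2 * log_partition_gf t"
      using log_comparison_sums[of t] by (simp only: log_comparison_sum_def sums_iff)
    then show "t * ln (sinh (pi / t) / (pi / t)) - 2 * (t * log_partition_gf t) = t * log_comparison_sum t"
      by (simp only: right_diff_distrib mult.left_commute)
  qed
  ultimately show ?thesis by (rule Lim_transform_eventually)
qed

text \<open>
  Write \<open>f t\<close> for \<open>t\<close> times the sum and \<open>c\<close> for the limit of \<open>f\<close> at \<open>0\<close>. By the halving estimate,
  \<open>f (2 * t)\<close> and \<open>f t\<close> differ by \<open>o(t)\<close>. Descending from \<open>T\<close> through \<open>T / 2\<close>, \<open>T / 4\<close>, \<open>\<dots>\<close> to the limit \<open>c\<close>, the errors form a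
  geometric series, so \<open>f T = c + o(T)\<close>.
\<close>

lemma tendsto_log_comparison_sum:
  "((\<lambda>t. log_comparison_sum t - (pi - pi\<^sup>2 / 3) / t) \<longlongrightarrow> 0) (at_right 0)"
proof (rule tendstoI)
  fix e :: real assume e: "e > 0"
  define f where "f = (\<lambda>t. t * log_comparison_sum t)"
  define c where "c = pi - pi\<^sup>2 / 3"
  define \<eta> where "\<eta> = e / 2"
  have \<eta>: "\<eta> > 0" "\<eta> < e" using e by (auto simp: \<eta>_def)
  have "((\<lambda>t. \<bar>log_comparison t\<bar> / 2 + 13 * pi / 2 * t) \<longlongrightarrow> \<bar>0\<bar> / 2 + 13 * pi / 2 * 0) (at_right 0)"
    by (intro tendsto_intros tendsto_log_comparison_0) auto
  then have "\<forall>\<^sub>F t in at_right 0. \<bar>log_comparison t\<bar> / 2 + 13 * pi / 2 * t < \<eta>"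
    using \<eta> by (intro order_tendstoD(2)) auto
  then obtain \<delta> where \<delta>: "\<delta> > 0"
    "\<And>t. 0 < t \<Longrightarrow> t < \<delta> \<Longrightarrow> \<bar>log_comparison t\<bar> / 2 + 13 * pi / 2 * t < \<eta>"
    unfolding eventually_at_right_field by auto
  have step: "\<bar>f (2 * t) - f t\<bar> \<le> t * \<eta>" if "0 < t" "t < \<delta>" for t
  proof -
    have "f (2 * t) - f t = - (t * (log_comparison_sum t - 2 * log_comparison_sum (2 * t)))"
      by (simp add: f_def algebra_simps)
    then have "\<bar>f (2 * t) - f t\<bar> = t * \<bar>log_comparison_sum t - 2 * log_comparison_sum (2 * t)\<bar>"
      using that by (simp add: abs_mult)
    also have "\<dots> \<le> t * \<eta>"
      using log_comparison_sum_halving[OF that(1)] \<delta>(2)[OF that] that(1) by (intro mult_left_mono) auto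
    finally show ?thesis .
  qed
  have main: "\<bar>f T - c\<bar> \<le> T * \<eta>" if T: "0 < T" "T < \<delta>" for T
  proof (rule LIMSEQ_le_const2)
    have "filterlim (\<lambda>J. T / 2 ^ J) (at_right 0) sequentially"
      using T by real_asymp
    with tendsto_times_log_comparison_sum have "(\<lambda>J. f (T / 2 ^ J)) \<longlonglongrightarrow> c"
      unfolding f_def c_def by (rule filterlim_compose)
    then show "(\<lambda>J. \<bar>f T - f (T / 2 ^ J)\<bar>) \<longlonglongrightarrow> \<bar>f T - c\<bar>"
      by (intro tendsto_intros)
    \<comment> \<open>The sum of the errors of the first \<open>J\<close> halvings, \<open>\<eta> * T * (1/2 + 1/4 + \<dots>)\<close>.\<close>
    have "\<bar>f T - f (T / 2 ^ J)\<bar> \<le> T * \<eta> * (1 - 1 / 2 ^ J)" for J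
    proof (induction J)
      case (Suc J)
      have "T / 2 ^ Suc J \<le> T" using T by (simp add: divide_le_eq mult_ge1_I)
      then have "\<bar>f (2 * (T / 2 ^ Suc J)) - f (T / 2 ^ Suc J)\<bar> \<le> T / 2 ^ Suc J * \<eta>"
        using T by (intro step) auto
      also have "2 * (T / 2 ^ Suc J) = T / 2 ^ J" by simp
      finally have "\<bar>f T - f (T / 2 ^ Suc J)\<bar> \<le> T * \<eta> * (1 - 1 / 2 ^ J) + T / 2 ^ Suc J * \<eta>"
        using Suc.IH by linarith
      also have "\<dots> = T * \<eta> * (1 - 1 / 2 ^ Suc J)"
        by (simp add: field_simps)
      finally show ?case .
    qed simp
    moreover have "T * \<eta> * (1 - 1 / 2 ^ J) \<le> T * \<eta>" for J
      using T \<eta> by (intro mult_left_le) auto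
    ultimately show "\<exists>N. \<forall>J\<ge>N. \<bar>f T - f (T / 2 ^ J)\<bar> \<le> T * \<eta>"
      by (meson order_trans)
  qed
  show "\<forall>\<^sub>F t in at_right 0. dist (log_comparison_sum t - (pi - pi\<^sup>2 / 3) / t) 0 < e"
    unfolding eventually_at_right_field
  proof (intro exI[of _ \<delta>] conjI allI impI \<delta>(1))
    fix t assume t: "0 < t" "t < \<delta>"
    have "log_comparison_sum t - c / t = (f t - c) / t"
      using t by (simp add: f_def field_simps)
    then have "\<bar>log_comparison_sum t - c / t\<bar> = \<bar>f t - c\<bar> / t"
      using t by simp
    also have "\<dots> \<le> \<eta>"
      using main[OF t] t by (simp add: divide_le_eq mult.commute)
    finally show "dist (log_comparison_sum t - (pi - pi\<^sup>2 / 3) / t) 0 < e"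
      using \<eta> by (simp add: c_def)
  qed
qed

lemma log_partition_gf_asymptotics:
  "((\<lambda>t. log_partition_gf t - (pi\<^sup>2 / (6 * t) + ln (t / (2 * pi)) / 2)) \<longlongrightarrow> 0) (at_right 0)"
proof -
  have "((\<lambda>t. ln (sinh (pi / t) / (pi / t)) - pi / t - ln (t / (2 * pi))) \<longlongrightarrow> 0) (at_right 0)"
    unfolding sinh_field_def by real_asymp
  from tendsto_divide[OF tendsto_diff[OF this tendsto_log_comparison_sum] tendsto_const, of 2]
  have "((\<lambda>t. (ln (sinh (pi / t) / (pi / t)) - pi / t - ln (t / (2 * pi))
      - (log_comparison_sum t - (pi - pi\<^sup>2 / 3) / t)) / 2) \<longlongrightarrow> (0 - 0) / 2) (at_right 0)"
    by (simp only: zero_neq_numeral not_False_eq_True simp_thms)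
  moreover have "\<forall>\<^sub>F t in at_right 0. (ln (sinh (pi / t) / (pi / t)) - pi / t - ln (t / (2 * pi))
      - (log_comparison_sum t - (pi - pi\<^sup>2 / 3) / t)) / 2
      = log_partition_gf t - (pi\<^sup>2 / (6 * t) + ln (t / (2 * pi)) / 2)"
    using eventually_at_right_less[of "0::real"]
  proof (rule eventually_mono)
    fix t :: real assume t: "0 < t"
    have sum: "log_comparison_sum t = ln (sinh (pi / t) / (pi / t)) - 2 * log_partition_gf t"
      using log_comparison_sums[OF t] by (simp only: log_comparison_sum_def sums_iff)
    have "(A - pi / t - B - (A - 2 * C - (pi - pi\<^sup>2 / 3) / t)) / 2 = C - (pi\<^sup>2 / (6 * t) + B / 2)"
      for A B C :: real
      using t by (simp add: field_simps)
    then show "(ln (sinh (pi / t) / (pi / t)) - pi / t - ln (t / (2 * pi))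
      - (log_comparison_sum t - (pi - pi\<^sup>2 / 3) / t)) / 2
      = log_partition_gf t - (pi\<^sup>2 / (6 * t) + ln (t / (2 * pi)) / 2)"
      unfolding sum .
  qed
  ultimately show ?thesis
    by (simp add: Lim_transform_eventually)
qed

section \<open>Fourier coefficients and decay off the real axis\<close>

lemma exp_imaginary_integral:
  fixes j :: int
  shows "(\<integral>y. indicator {-pi..pi} y *\<^sub>R exp (\<i> * of_int j * of_real y) \<partial>lborel) = (if j = 0 then 2 * of_real pi else 0)"
proof (cases "j = 0")
  case True
  have "(\<integral>y. indicator {-pi..pi} y *\<^sub>R (1::complex) \<partial>lborel) = of_real pi - of_real (- pi)"
    by (rule integral_FTC_atLeastAtMost)
       (auto intro!: derivative_eq_intros simp: has_vector_derivative_of_real)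
  then show ?thesis using True by simp
next
  case False
  let ?F = "\<lambda>y::real. exp (\<i> * of_int j * of_real y) / (\<i> * of_int j)"
  have "(\<integral>y. indicator {-pi..pi} y *\<^sub>R exp (\<i> * of_int j * of_real y) \<partial>lborel) = ?F pi - ?F (- pi)"
  proof (rule integral_FTC_atLeastAtMost)
    fix y :: real
    have "((\<lambda>z. exp (\<i> * of_int j * z) / (\<i> * of_int j)) has_field_derivative
        exp (\<i> * of_int j * of_real y)) (at (of_real y))"
      using False by (auto intro!: derivative_eq_intros)
    then show "(?F has_vector_derivative exp (\<i> * of_int j * of_real y)) (at y within {-pi..pi})"
      by (rule has_vector_derivative_real_field[OF DERIV_subset]) simp
  qed (auto intro!: continuous_intros)
  also have "exp (\<i> * of_int j * of_real (- pi)) = exp (\<i> * of_int j * of_real pi)"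
  proof -
    have "exp (\<i> * of_int j * of_real pi) = exp (\<i> * of_int j * of_real (- pi)) * exp (2 * of_int j * of_real pi * \<i>)"
      unfolding exp_add[symmetric] by (rule arg_cong[of _ _ exp]) (simp add: algebra_simps)
    also have "exp (2 * of_int j * of_real pi * \<i>) = 1"
      by (auto simp: exp_eq_1)
    finally show ?thesis by simp
  qed
  finally show ?thesis using False by simp
qed

lemma partition_number_fourier:
  assumes "0 < t"
  shows "(\<integral>y. indicator {-pi..pi} y *\<^sub>R (partition_gf (of_real t + \<i> * of_real y) * exp (\<i> * of_nat n * of_real y)) \<partial>lborel)
       = of_real (2 * pi * real (partition_number n) * exp (- (real n * t)))"
proof -
  define c where "c = (\<lambda>k. complex_of_real (real (partition_number k) * exp (- t) ^ k))"
  define g where "g = (\<lambda>k (y::real). indicator {-pi..pi} y *\<^sub>R exp (\<i> * of_int (int n - int k) * of_real y))"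
  have c_summable: "summable (\<lambda>k. norm (c k))"
    using summable_partition_number_real[of "exp (- t)"] assms by (simp add: c_def norm_mult norm_power)
  have g_int: "integrable lborel (g k)" for k
    unfolding g_def set_integrable_def[symmetric]
    by (intro borel_integrable_atLeastAtMost' continuous_intros)
  have g_norm: "norm (g k y) = indicator {-pi..pi} y" for k y
    by (simp add: g_def split: split_indicator)
  have summand: "c k * g k y = indicator {-pi..pi} y *\<^sub>R
      (of_nat (partition_number k) * exp (- (of_real t + \<i> * of_real y)) ^ k * exp (\<i> * of_nat n * of_real y))" for k y
    by (simp add: c_def g_def exp_of_nat_mult[symmetric] algebra_simps flip: exp_of_real exp_add)
  have gf_sum: "(\<Sum>k. c k * g k y) = indicator {-pi..pi} y *\<^sub>R
      (partition_gf (of_real t + \<i> * of_real y) * exp (\<i> * of_nat n * of_real y))" for y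
  proof -
    have "summable (\<lambda>k. of_nat (partition_number k) * exp (- (of_real t + \<i> * of_real y)) ^ k)"
      using assms by (intro summable_norm_cancel[OF summable_norm_partition_number]) simp
    note summable = this
    show ?thesis
      unfolding summand partition_gf_def suminf_mult2[OF summable]
      by (rule suminf_scaleR_right[symmetric, OF summable_mult2[OF summable]])
  qed
  have "(\<lambda>k. \<integral>y. c k * g k y \<partial>lborel) sums (\<integral>y. (\<Sum>k. c k * g k y) \<partial>lborel)"
  proof (rule sums_integral)
    show "integrable lborel (\<lambda>y. c k * g k y)" for k
      using g_int by simp
    show "AE y in lborel. summable (\<lambda>k. norm (c k * g k y))"
      using c_summable by (simp add: norm_mult g_norm summable_mult2)
    have "(\<integral>y. norm (c k * g k y) \<partial>lborel) = norm (c k) * (2 * pi)" for k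
      by (simp add: norm_mult g_norm)
    then show "summable (\<lambda>k. \<integral>y. norm (c k * g k y) \<partial>lborel)"
      using c_summable by (simp add: summable_mult2)
  qed
  moreover have "(\<integral>y. c k * g k y \<partial>lborel) = (if k = n then c n * (2 * of_real pi) else 0)" for k
    unfolding integral_mult_right_zero using exp_imaginary_integral[of "int n - int k"]
    by (simp add: g_def)
  ultimately have "(\<integral>y. (\<Sum>k. c k * g k y) \<partial>lborel) = c n * (2 * of_real pi)"
    using sums_single[of n "\<lambda>_. c n * (2 * of_real pi)"] sums_unique2 by (simp add: eq_commute) blast
  then show ?thesis
    unfolding gf_sum by (simp add: c_def exp_of_nat_mult[symmetric] mult_ac)
qed

text \<open>
  This is \<open>1 - cos y = 2 * (sin (y / 2))\<^sup>2\<close> with the cubic Taylor bound for the sine, which gives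
  \<open>sin x \<ge> x / 2\<close> on the range of the half angle.
\<close>

lemma one_minus_cos_ge:
  fixes y :: real
  assumes "\<bar>y\<bar> \<le> pi"
  shows "y\<^sup>2 / 8 \<le> 1 - cos y"
proof -
  define x where "x = \<bar>y\<bar> / 2"
  have x: "0 \<le> x" "x \<le> 1.6"
    using assms pi_approx by (auto simp: x_def)
  have "\<bar>sin x - (\<Sum>m<3. sin_coeff m * x ^ m)\<bar> \<le> inverse (fact 3) * \<bar>x\<bar> ^ 3"
    by (rule Maclaurin_sin_bound)
  then have "\<bar>sin x - x\<bar> \<le> x ^ 3 / 6"
    using x by (simp add: sin_coeff_def eval_nat_numeral)
  then have "x - x ^ 3 / 6 \<le> sin x"
    by linarith
  moreover have "x ^ 3 / 6 \<le> x / 2"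
  proof -
    have "x\<^sup>2 \<le> 1.6\<^sup>2" using x by (intro power_mono) auto
    then have "x * x\<^sup>2 \<le> x * 3" using x by (intro mult_left_mono) (auto simp: power2_eq_square)
    then show ?thesis by (simp add: power3_eq_cube power2_eq_square)
  qed
  ultimately have "(x / 2)\<^sup>2 \<le> (sin x)\<^sup>2"
    using x by (intro power_mono) auto
  moreover have "cos y = 1 - 2 * (sin x)\<^sup>2"
    using cos_double_sin[of x] by (simp add: x_def)
  moreover have "(x / 2)\<^sup>2 = y\<^sup>2 / 16"
    by (simp add: x_def power_divide)
  ultimately show ?thesis by linarith
qed

text \<open>
  Every term of the exponent at \<open>s\<close> has real part at most the corresponding term at \<open>Re s\<close>. The saving
  in the first term alone is kept.
\<close>

lemma norm_partition_gf_le: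
  fixes s :: complex
  assumes "0 < Re s"
  shows "norm (partition_gf s) \<le> exp (log_partition_gf (Re s)) *
           exp (Re (1 / (exp s - 1)) - 1 / (exp (Re s) - 1))"
proof -
  define t where "t = Re s"
  define a where "a = (\<lambda>m. 1 / (exp (of_nat (Suc m) * s) - 1) / of_nat (Suc m))"
  define b where "b = (\<lambda>m. 1 / (exp (real (Suc m) * t) - 1) / real (Suc m))"
  have t: "t > 0" using assms by (simp add: t_def)
  have sa: "summable a" unfolding a_def by (rule summable_partition_gf_exponent[OF assms])
  have "summable (\<lambda>m. complex_of_real (b m))"
    using summable_partition_gf_exponent[of "of_real t"] t by (simp add: b_def flip: exp_of_real)
  then have sb: "summable b" by (simp only: summable_complex_of_real)
  have le: "Re (a m) \<le> b m" for m
  proof -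
    define k where "k = real (Suc m)"
    have k: "k > 0" by (simp add: k_def)
    have "exp (k * t) - 1 \<le> norm (exp (of_nat (Suc m) * s) - 1)"
      using norm_exp_minus_one_ge(1)[of "of_nat (Suc m) * s"] t by (simp add: k_def t_def)
    moreover have "0 < exp (k * t) - 1" using k t by simp
    ultimately have "1 / norm (exp (of_nat (Suc m) * s) - 1) / k \<le> 1 / (exp (k * t) - 1) / k"
      using k by (intro divide_right_mono divide_left_mono mult_pos_pos) auto
    moreover have "norm (a m) = 1 / norm (exp (of_nat (Suc m) * s) - 1) / k"
      by (simp only: a_def norm_divide norm_of_nat norm_one k_def)
    ultimately have "norm (a m) \<le> b m" by (simp only: b_def k_def)
    then show ?thesis using complex_Re_le_cmod[of "a m"] by linarith
  qed
  have "Re (suminf a) = (\<Sum>m. Re (a m))"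
    by (rule Re_suminf[OF sa])
  also have "\<dots> = Re (a 0) + (\<Sum>m. Re (a (Suc m)))"
    using suminf_split_head[OF summable_Re[OF sa]] by simp
  also have "\<dots> \<le> Re (a 0) + (\<Sum>m. b (Suc m))"
    using sa sb by (intro add_left_mono suminf_le le) (auto intro: summable_Re simp: summable_Suc_iff)
  also have "(\<Sum>m. b (Suc m)) = suminf b - b 0"
    by (rule suminf_split_head[OF sb])
  finally have "Re (suminf a) \<le> log_partition_gf t + (Re (1 / (exp s - 1)) - 1 / (exp t - 1))"
    by (simp add: a_def b_def log_partition_gf_def)
  then show ?thesis
    using partition_gf_eq_exp[OF assms] by (simp add: a_def t_def flip: exp_add)
qed

text \<open>
  With \<open>\<delta> = 1 - exp (- t)\<close> and \<open>A = 2 * exp (- t) * (1 - cos y)\<close>, the right-hand side equals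
  \<open>A * (1 - \<delta> / 2) / (\<delta> * (\<delta>\<^sup>2 + A))\<close>. This is increasing in \<open>A\<close> and decreasing in \<open>\<delta>\<close>, so the bounds
  \<open>A \<ge> y\<^sup>2 / 8\<close> and \<open>\<delta> \<le> t\<close> can be inserted, together with \<open>1 - \<delta> / 2 \<ge> 1 / 2\<close>.
\<close>

lemma bose_gap:
  fixes t y :: real
  assumes t: "0 < t" "t \<le> 1 / 2" and y: "\<bar>y\<bar> \<le> pi"
  shows "y\<^sup>2 / (2 * t * (8 * t\<^sup>2 + y\<^sup>2)) \<le> 1 / (exp t - 1) - Re (1 / (exp (of_real t + \<i> * of_real y) - 1))"
proof -
  define r where "r = exp (- t)"
  define \<delta> where "\<delta> = 1 - r"
  define A where "A = 2 * r * (1 - cos y)"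
  have "1 - t \<le> r" using exp_ge_add_one_self[of "- t"] by (simp add: r_def)
  then have r: "1 / 2 \<le> r" "r < 1" using t by (auto simp: r_def)
  have \<delta>: "0 < \<delta>" "\<delta> \<le> t" using r \<open>1 - t \<le> r\<close> by (auto simp: \<delta>_def)
  have A: "y\<^sup>2 / 8 \<le> A"
  proof -
    have "y\<^sup>2 / 8 \<le> 1 * (1 - cos y)" using one_minus_cos_ge[OF y] by simp
    also have "\<dots> \<le> (2 * r) * (1 - cos y)" using r by (intro mult_right_mono) auto
    finally show ?thesis by (simp add: A_def)
  qed
  have A0: "A \<ge> 0" using A by (rule order_trans[rotated]) simp
  have real_part: "1 / (exp t - 1) = 1 / \<delta> - 1"
    using \<delta> by (simp add: \<delta>_def r_def exp_minus field_simps)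
  define z where "z = exp (- (of_real t + \<i> * of_real y))"
  have z: "Re z = r * cos y" "Im z = - (r * sin y)"
    by (simp_all add: z_def r_def Re_exp Im_exp)
  have nz: "(norm (1 - z))\<^sup>2 = \<delta>\<^sup>2 + A"
  proof -
    have "(norm (1 - z))\<^sup>2 = (1 - r * cos y)\<^sup>2 + (r * sin y)\<^sup>2"
      by (simp add: cmod_power2 z)
    also have "\<dots> = \<delta>\<^sup>2 + A"
      unfolding power_mult_distrib sin_squared_eq
      by (simp add: \<delta>_def A_def power2_eq_square algebra_simps)
    finally show ?thesis .
  qed
  have "norm z < 1" using t by (simp add: z_def)
  then have "1 - z \<noteq> 0" by auto
  have "1 / (exp (of_real t + \<i> * of_real y) - 1) = 1 / (1 - z) - 1"
  proof -
    have "1 / (w - 1) = 1 / (1 - inverse w) - 1" if "w \<noteq> 0" "1 - inverse w \<noteq> 0" for w :: complex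
      using that by (simp add: field_simps)
    then show ?thesis
      using \<open>1 - z \<noteq> 0\<close> by (simp only: z_def exp_minus exp_not_eq_zero not_False_eq_True simp_thms)
  qed
  then have "Re (1 / (exp (of_real t + \<i> * of_real y) - 1)) = Re (1 / (1 - z)) - 1"
    by simp
  also have "Re (1 / (1 - z)) = (1 - r * cos y) / (norm (1 - z))\<^sup>2"
    by (simp add: Re_divide cmod_power2 z)
  also have "1 - r * cos y = \<delta> + A / 2"
    by (simp add: \<delta>_def A_def field_simps)
  finally have complex_part: "Re (1 / (exp (of_real t + \<i> * of_real y) - 1)) = (\<delta> + A / 2) / (\<delta>\<^sup>2 + A) - 1"
    unfolding nz .
  have pos: "\<delta>\<^sup>2 + A > 0" using \<delta> A0 by (simp add: add_pos_nonneg)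
  have "y\<^sup>2 / (2 * t * (8 * t\<^sup>2 + y\<^sup>2)) = (y\<^sup>2 / 8) / (t\<^sup>2 + y\<^sup>2 / 8) / (2 * t)"
    using t by (simp add: field_simps)
  also have "\<dots> \<le> A / (t\<^sup>2 + A) / (2 * t)"
  proof (intro divide_right_mono)
    have "p / (q + p) \<le> P / (q + P)" if "0 \<le> p" "p \<le> P" "0 < q" for p P q :: real
      using that by (simp add: divide_le_eq le_divide_eq field_simps add_pos_nonneg)
    from this[of "y\<^sup>2 / 8" A "t\<^sup>2"] show "(y\<^sup>2 / 8) / (t\<^sup>2 + y\<^sup>2 / 8) \<le> A / (t\<^sup>2 + A)"
      using A t by (simp only: zero_le_divide_iff zero_le_power2 zero_less_power) simp
  qed (use t in auto)
  also have "\<dots> \<le> A / (\<delta>\<^sup>2 + A) / (2 * \<delta>)"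
    using \<delta> A0 pos by (intro frac_le divide_left_mono add_right_mono power_mono mult_pos_pos divide_nonneg_nonneg)
      (auto intro: add_pos_nonneg)
  also have "\<dots> \<le> A * (1 - \<delta> / 2) / (\<delta> * (\<delta>\<^sup>2 + A))"
  proof -
    have "A / (\<delta>\<^sup>2 + A) / (2 * \<delta>) = A * (1 / 2) / (\<delta> * (\<delta>\<^sup>2 + A))"
      by (simp add: mult_ac)
    also have "\<dots> \<le> A * (1 - \<delta> / 2) / (\<delta> * (\<delta>\<^sup>2 + A))"
      using \<delta> A0 pos t by (intro divide_right_mono mult_left_mono) auto
    finally show ?thesis .
  qed
  also have "\<dots> = 1 / \<delta> - (\<delta> + A / 2) / (\<delta>\<^sup>2 + A)"
    using \<delta> pos by (simp add: divide_simps) (simp add: power2_eq_square algebra_simps)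
  finally show ?thesis
    unfolding real_part complex_part by simp
qed

text \<open>
  The function \<open>E = u\<^sup>2 / (16 + 2 * t * u\<^sup>2)\<close> is of order \<open>u\<^sup>2\<close> for moderate \<open>u\<close> and of order \<open>1 / t\<close> for large
  \<open>u\<close>. The assumption that \<open>t ^ 3 * u\<^sup>2\<close> is bounded turns the latter into a power of \<open>u\<close>, so
  \<open>exp (- E) \<le> 6 / E ^ 3\<close> gives a bound in terms of \<open>u\<close> only.
\<close>

lemma exp_minus_gap_le:
  fixes t u :: real
  assumes "0 < t" "t ^ 3 * u\<^sup>2 \<le> 10"
  shows "exp (- (u\<^sup>2 / (16 + 2 * t * u\<^sup>2))) \<le> 210000 / (1 + u\<^sup>2)"
proof (cases "\<bar>u\<bar> \<le> 1")
  case True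
  have "exp (- (u\<^sup>2 / (16 + 2 * t * u\<^sup>2))) \<le> 1"
    using assms by simp
  also have "1 \<le> 210000 / (1 + u\<^sup>2)"
    using True abs_square_le_1[of u] by (simp add: le_divide_eq add_pos_nonneg)
  finally show ?thesis .
next
  case False
  then have u: "1 \<le> u\<^sup>2" using abs_square_less_1[of u] by simp
  define E where "E = u\<^sup>2 / (16 + 2 * t * u\<^sup>2)"
  define D where "D = 16 + 2 * t * u\<^sup>2"
  have D: "D > 0" using assms by (simp add: D_def add_pos_nonneg)
  have E: "E > 0" "E = u\<^sup>2 / D"
    using D u unfolding E_def D_def by (auto intro!: divide_pos_pos)
  have "E ^ 3 / 6 \<le> exp E"
  proof -
    have "E ^ 3 /\<^sub>R fact 3 \<le> exp E"
      unfolding exp_def using E sum_le_suminf[of "\<lambda>n. E ^ n /\<^sub>R fact n" "{3}"] summable_exp_generic[of E]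
      by simp
    then show ?thesis by (simp add: fact_numeral)
  qed
  then have "1 / exp E \<le> 1 / (E ^ 3 / 6)"
    using E(1) by (intro divide_left_mono) auto
  then have "exp (- E) \<le> 6 / E ^ 3"
    by (simp add: exp_minus inverse_eq_divide)
  also have "\<dots> = 6 * D ^ 3 / (u\<^sup>2) ^ 3"
    unfolding E(2) by (simp add: power_divide)
  also have "D ^ 3 \<le> 4 * (16 ^ 3 + (2 * t * u\<^sup>2) ^ 3)"
  proof -
    have cube: "(p + q) ^ 3 \<le> 4 * (p ^ 3 + q ^ 3)" if "0 \<le> p" "0 \<le> q" for p q :: real
    proof -
      have "0 \<le> 3 * (p + q) * (p - q)\<^sup>2" using that by simp
      then show ?thesis by (simp add: power3_eq_cube power2_eq_square algebra_simps)
    qed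
    show ?thesis unfolding D_def by (rule cube) (use assms in auto)
  qed
  also have "(2 * t * u\<^sup>2) ^ 3 = 8 * (t ^ 3 * u\<^sup>2) * (u\<^sup>2)\<^sup>2"
    by (simp add: power3_eq_cube power2_eq_square)
  also have "4 * (16 ^ 3 + 8 * (t ^ 3 * u\<^sup>2) * (u\<^sup>2)\<^sup>2) \<le> 4 * (16 ^ 3 * (u\<^sup>2)\<^sup>2 + 8 * 10 * (u\<^sup>2)\<^sup>2)"
  proof -
    have linear: "4 * (16 ^ 3 + 8 * X * Q) \<le> 4 * (16 ^ 3 * Q + 8 * 10 * Q)"
      if "1 \<le> Q" "X * Q \<le> 10 * Q" for X Q :: real
    proof -
      have "4 * (16 ^ 3 + 8 * X * Q) = 16384 + 32 * (X * Q)" by simp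
      also have "\<dots> \<le> 16384 * Q + 32 * (10 * Q)"
        using that by (intro add_mono mult_left_mono) auto
      also have "\<dots> = 4 * (16 ^ 3 * Q + 8 * 10 * Q)" by simp
      finally show ?thesis .
    qed
    have "1 \<le> (u\<^sup>2)\<^sup>2" using u by (rule one_le_power)
    moreover have "t ^ 3 * u\<^sup>2 * (u\<^sup>2)\<^sup>2 \<le> 10 * (u\<^sup>2)\<^sup>2"
      using assms by (intro mult_right_mono) auto
    ultimately show ?thesis by (rule linear)
  qed
  finally have "exp (- E) \<le> 6 * (4 * (16 ^ 3 * (u\<^sup>2)\<^sup>2 + 8 * 10 * (u\<^sup>2)\<^sup>2)) / (u\<^sup>2) ^ 3"
    using u by (simp add: divide_right_mono)
  also have "\<dots> = 100224 / u\<^sup>2"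
    using u by (simp add: field_simps power3_eq_cube power2_eq_square)
  also have "\<dots> \<le> 210000 / (1 + u\<^sup>2)"
  proof -
    have "100224 * (1 + u\<^sup>2) \<le> 210000 * u\<^sup>2" using u by simp
    then show ?thesis using u by (simp add: divide_simps add_pos_pos)
  qed
  finally show ?thesis by (simp add: E_def)
qed

section \<open>The saddle point\<close>

text \<open>
  The Fourier integrand relative to the value at the saddle point, in the variable \<open>u\<close> with
  \<open>y = t powr (3/2) * u\<close>: the exponent \<open>3/2\<close> is the one for which the quadratic term
  \<open>y\<^sup>2 / t ^ 3\<close> of \<open>pi\<^sup>2 / (6 * (t + \<i> * y))\<close> is of constant order.
\<close>

definition rescaled_integrand :: "real \<Rightarrow> nat \<Rightarrow> real \<Rightarrow> complex" where
  "rescaled_integrand t n u = indicator {-pi..pi} (t * sqrt t * u) *\<^sub>R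
     (partition_gf (of_real t + \<i> * of_real (t * sqrt t * u))
       * exp (\<i> * of_nat n * of_real (t * sqrt t * u)) / of_real (exp (log_partition_gf t)))"

lemma integral_rescaled_integrand:
  assumes "0 < t"
  shows "(\<integral>u. rescaled_integrand t n u \<partial>lborel) =
     of_real (2 * pi * real (partition_number n) * exp (- (real n * t)) / (t * sqrt t * exp (log_partition_gf t)))"
proof -
  define c where "c = t * sqrt t"
  have c: "c > 0" using assms by (simp add: c_def)
  let ?f = "\<lambda>y. indicator {-pi..pi} y *\<^sub>R
      (partition_gf (of_real t + \<i> * of_real y) * exp (\<i> * of_nat n * of_real y))"
  have "(\<integral>y. ?f y \<partial>lborel) = \<bar>c\<bar> *\<^sub>R (\<integral>u. ?f (0 + c * u) \<partial>lborel)"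
    using c by (intro lborel_integral_real_affine) auto
  then have "(\<integral>u. ?f (c * u) \<partial>lborel)
      = of_real (2 * pi * real (partition_number n) * exp (- (real n * t)) / c)"
    using c unfolding partition_number_fourier[OF assms] by (simp add: scaleR_conv_of_real field_simps)
  moreover have "rescaled_integrand t n = (\<lambda>u. ?f (c * u) / of_real (exp (log_partition_gf t)))"
    by (rule ext) (auto simp: rescaled_integrand_def c_def indicator_def)
  ultimately show ?thesis
    by (simp add: c_def)
qed

lemma borel_measurable_rescaled_integrand: "rescaled_integrand t n \<in> borel_measurable borel"
  unfolding rescaled_integrand_def[abs_def] partition_gf_def by measurable

lemma norm_rescaled_integrand_le:
  assumes "0 < t" "t \<le> 1 / 2"
  shows "norm (rescaled_integrand t n u) \<le> 210000 / (1 + u\<^sup>2)"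
proof (cases "\<bar>t * sqrt t * u\<bar> \<le> pi")
  case False
  then have "rescaled_integrand t n u = 0"
    by (auto simp: rescaled_integrand_def indicator_def)
  then show ?thesis by (simp add: add_pos_nonneg)
next
  case True
  define y where "y = t * sqrt t * u"
  have y: "\<bar>y\<bar> \<le> pi" "y\<^sup>2 = t ^ 3 * u\<^sup>2"
    using True assms by (auto simp: y_def power_mult_distrib power2_eq_square power3_eq_cube)
  have "y\<^sup>2 \<le> 10"
  proof -
    have "\<bar>y\<bar>\<^sup>2 \<le> 3.15\<^sup>2" using y(1) pi_approx by (intro power_mono) auto
    then show ?thesis by (simp add: power2_eq_square)
  qed
  have "norm (exp (\<i> * of_nat n * of_real y)) = 1" by simp
  then have "norm (rescaled_integrand t n u) \<le> norm (partition_gf (of_real t + \<i> * of_real y)) / exp (log_partition_gf t)"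
    unfolding rescaled_integrand_def y_def[symmetric]
    by (auto simp: norm_mult norm_divide indicator_def)
  also have "\<dots> \<le> exp (log_partition_gf t) *
      exp (Re (1 / (exp (of_real t + \<i> * of_real y) - 1)) - 1 / (exp t - 1)) / exp (log_partition_gf t)"
    using norm_partition_gf_le[of "of_real t + \<i> * of_real y"] assms by (intro divide_right_mono) auto
  also have "\<dots> = exp (Re (1 / (exp (of_real t + \<i> * of_real y) - 1)) - 1 / (exp t - 1))"
    by simp
  also have "\<dots> \<le> exp (- (y\<^sup>2 / (2 * t * (8 * t\<^sup>2 + y\<^sup>2))))"
    using bose_gap[OF assms y(1)] by simp
  also have "y\<^sup>2 / (2 * t * (8 * t\<^sup>2 + y\<^sup>2)) = u\<^sup>2 / (16 + 2 * t * u\<^sup>2)"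
  proof -
    have "2 * t * (8 * t\<^sup>2 + y\<^sup>2) = t ^ 3 * (16 + 2 * t * u\<^sup>2)"
      unfolding y(2) by (simp add: power2_eq_square power3_eq_cube algebra_simps)
    then show ?thesis using assms unfolding y(2) by simp
  qed
  also have "exp (- (u\<^sup>2 / (16 + 2 * t * u\<^sup>2))) \<le> 210000 / (1 + u\<^sup>2)"
    using assms \<open>y\<^sup>2 \<le> 10\<close> y(2) by (intro exp_minus_gap_le) auto
  finally show ?thesis .
qed

text \<open>
  The third assumption is the saddle point condition: \<open>n\<close> is minus the derivative of \<open>pi\<^sup>2 / (6 * s)\<close> at
  \<open>s = t\<close>. It makes the oscillating factor cancel the linear term, by
  \<open>1 / (1 + w) - 1 + w = w\<^sup>2 / (1 + w)\<close> with \<open>w = \<i> * sqrt t * u\<close>.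
\<close>

lemma rescaled_integrand_eq:
  assumes "0 < t" "t \<le> 1" "real n * t = pi\<^sup>2 / (6 * t)" "\<bar>sqrt t * u\<bar> \<le> 1"
  obtains E where "norm E \<le> 6 * pi * \<bar>sqrt t * u\<bar>"
    "rescaled_integrand t n u = exp (- of_real (pi\<^sup>2 * u\<^sup>2 / 6) / (1 + \<i> * of_real (sqrt t * u)) + E)"
proof -
  define v where "v = sqrt t * u"
  have v: "\<bar>v\<bar> \<le> 1" "v\<^sup>2 = t * u\<^sup>2" using assms by (auto simp: v_def power_mult_distrib)
  have y: "t * sqrt t * u = t * v" by (simp add: v_def)
  have "\<bar>t * v\<bar> \<le> 1 * 1" unfolding abs_mult using assms v by (intro mult_mono) auto
  then have "indicator {-pi..pi} (t * v) = (1::real)"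
    using pi_gt3 by (auto simp: indicator_def abs_le_iff)
  obtain E where E: "norm E \<le> 6 * pi * \<bar>v\<bar>"
    "partition_gf (t * (1 + \<i> * v)) =
       partition_gf t * exp (pi\<^sup>2 / (6 * t) * (1 / (1 + \<i> * v) - 1) + E)"
    by (rule partition_gf_quotient[OF assms(1) v(1)])
  have ne: "1 + \<i> * complex_of_real v \<noteq> 0"
    by (auto simp: complex_eq_iff)
  have "rescaled_integrand t n u
      = exp (pi\<^sup>2 / (6 * t) * (1 / (1 + \<i> * v) - 1) + E) * exp (\<i> * of_nat n * of_real (t * v))"
    unfolding rescaled_integrand_def y \<open>indicator {-pi..pi} (t * v) = (1::real)\<close>
    using E(2) partition_gf_of_real[OF assms(1)] by (simp add: distrib_left mult_ac)
  also have "\<i> * of_nat n * complex_of_real (t * v) = pi\<^sup>2 / (6 * t) * (\<i> * v)"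
  proof -
    have "\<i> * of_nat n * complex_of_real (t * v) = of_real (real n * t) * (\<i> * v)"
      by simp
    then show ?thesis unfolding assms(3) by simp
  qed
  also have "exp (pi\<^sup>2 / (6 * t) * (1 / (1 + \<i> * v) - 1) + E) * exp (pi\<^sup>2 / (6 * t) * (\<i> * v))
      = exp (pi\<^sup>2 / (6 * t) * (1 / (1 + \<i> * v) - 1 + \<i> * v) + E)"
    unfolding exp_add[symmetric] by (rule arg_cong[of _ _ exp]) (simp only: distrib_left add_ac)
  also have "1 / (1 + \<i> * v) - 1 + \<i> * v = - of_real (v\<^sup>2) / (1 + \<i> * v)"
    using ne by (simp add: field_simps power2_eq_square)
  also have "pi\<^sup>2 / (6 * t) * (- of_real (v\<^sup>2) / (1 + \<i> * v)) = - of_real (pi\<^sup>2 * u\<^sup>2 / 6) / (1 + \<i> * v)"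
    unfolding v(2) using assms(1) by simp
  finally show ?thesis
    using that[of E] E(1) by (simp add: v_def)
qed

lemma tendsto_rescaled_integrand:
  assumes t: "filterlim t (at_right 0) sequentially"
    and saddle: "\<forall>\<^sub>F n in sequentially. real n * t n = pi\<^sup>2 / (6 * t n)"
  shows "(\<lambda>n. rescaled_integrand (t n) n u) \<longlonglongrightarrow> of_real (exp (- (pi\<^sup>2 * u\<^sup>2 / 6)))"
proof -
  define v where "v = (\<lambda>n. sqrt (t n) * u)"
  define good where "good = (\<lambda>n. 0 < t n \<and> t n \<le> 1 \<and> real n * t n = pi\<^sup>2 / (6 * t n) \<and> \<bar>v n\<bar> \<le> 1)"
  have t0: "t \<longlonglongrightarrow> 0" and tpos: "\<forall>\<^sub>F n in sequentially. 0 < t n"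
    using t by (auto simp: filterlim_at elim: eventually_mono)
  have "v \<longlonglongrightarrow> sqrt 0 * u"
    unfolding v_def by (intro tendsto_intros t0)
  then have v0: "v \<longlonglongrightarrow> 0" by simp
  have "\<forall>\<^sub>F n in sequentially. \<bar>v n\<bar> < 1"
    using tendsto_rabs[OF v0] by (intro order_tendstoD(2)) auto
  moreover have "\<forall>\<^sub>F n in sequentially. t n < 1"
    using t0 by (intro order_tendstoD(2)) auto
  ultimately have ev: "\<forall>\<^sub>F n in sequentially. good n"
    using tpos saddle by eventually_elim (auto simp: good_def)
  have "\<exists>E. good n \<longrightarrow> norm E \<le> 6 * pi * \<bar>v n\<bar> \<and>
      rescaled_integrand (t n) n u = exp (- of_real (pi\<^sup>2 * u\<^sup>2 / 6) / (1 + \<i> * of_real (v n)) + E)" for n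
    using rescaled_integrand_eq[of "t n" n u] unfolding good_def v_def by metis
  then obtain E where E: "\<And>n. good n \<Longrightarrow> norm (E n) \<le> 6 * pi * \<bar>v n\<bar>"
    "\<And>n. good n \<Longrightarrow> rescaled_integrand (t n) n u =
        exp (- of_real (pi\<^sup>2 * u\<^sup>2 / 6) / (1 + \<i> * of_real (v n)) + E n)"
    by metis
  have E0: "E \<longlonglongrightarrow> 0"
  proof (rule Lim_null_comparison)
    show "\<forall>\<^sub>F n in sequentially. norm (E n) \<le> 6 * pi * \<bar>v n\<bar>"
      using ev by (rule eventually_mono) (rule E(1))
    show "(\<lambda>n. 6 * pi * \<bar>v n\<bar>) \<longlonglongrightarrow> 0"
      using tendsto_mult_right_zero[OF tendsto_rabs_zero[OF v0]] by simp
  qed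
  have lim: "(\<lambda>n. exp (- of_real (pi\<^sup>2 * u\<^sup>2 / 6) / (1 + \<i> * of_real (v n)) + E n))
      \<longlonglongrightarrow> exp (- of_real (pi\<^sup>2 * u\<^sup>2 / 6) / (1 + \<i> * of_real 0) + 0)"
    by (intro tendsto_intros v0 E0) auto
  have eq: "\<forall>\<^sub>F n in sequentially.
      exp (- of_real (pi\<^sup>2 * u\<^sup>2 / 6) / (1 + \<i> * of_real (v n)) + E n) = rescaled_integrand (t n) n u"
    using ev by (rule eventually_mono) (simp only: E(2))
  have limit_value: "exp (- of_real (pi\<^sup>2 * u\<^sup>2 / 6) / (1 + \<i> * of_real 0) + 0)
      = complex_of_real (exp (- (pi\<^sup>2 * u\<^sup>2 / 6)))"
    by (simp add: exp_of_real[symmetric])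
  show ?thesis
    using Lim_transform_eventually[OF lim eq] unfolding limit_value .
qed

text \<open>
  The integrand is a multiple of the normal density of variance \<open>3 / pi\<^sup>2\<close>.
\<close>

lemma gaussian_integral:
  "(\<integral>u. exp (- (pi\<^sup>2 * u\<^sup>2 / 6)) \<partial>lborel) = sqrt (6 / pi)"
proof -
  define \<sigma> where "\<sigma> = sqrt 3 / pi"
  have \<sigma>: "\<sigma>\<^sup>2 = 3 / pi\<^sup>2" "\<sigma> > 0"
    by (simp_all add: \<sigma>_def power_divide)
  have scale: "2 * pi * \<sigma>\<^sup>2 = 6 / pi"
    unfolding \<sigma>(1) by (simp add: power2_eq_square)
  have "exp (- (pi\<^sup>2 * u\<^sup>2 / 6)) = sqrt (6 / pi) * normal_density 0 \<sigma> u" for u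
  proof -
    have "- (u - 0)\<^sup>2 / (2 * \<sigma>\<^sup>2) = - (pi\<^sup>2 * u\<^sup>2 / 6)"
      unfolding \<sigma>(1) by simp
    then show ?thesis
      unfolding normal_density_def scale by simp
  qed
  then show ?thesis
    using \<sigma>(2) by simp
qed

lemma tendsto_integral_rescaled_integrand:
  assumes t: "filterlim t (at_right 0) sequentially"
    and saddle: "\<forall>\<^sub>F n in sequentially. real n * t n = pi\<^sup>2 / (6 * t n)"
  shows "(\<lambda>n. \<integral>u. rescaled_integrand (t n) n u \<partial>lborel) \<longlonglongrightarrow> of_real (sqrt (6 / pi))"
proof -
  have "\<forall>\<^sub>F n in sequentially. t n \<in> {0<..<1/2}"
    by (rule eventually_compose_filterlim[OF eventually_at_right_real t]) simp
  then obtain N where N: "\<And>n. N \<le> n \<Longrightarrow> 0 < t n \<and> t n \<le> 1 / 2"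
    unfolding eventually_sequentially by fastforce
  have "(\<lambda>n. \<integral>u. rescaled_integrand (t (n + N)) (n + N) u \<partial>lborel)
      \<longlonglongrightarrow> (\<integral>u. complex_of_real (exp (- (pi\<^sup>2 * u\<^sup>2 / 6))) \<partial>lborel)"
  proof (rule integral_dominated_convergence)
    show "integrable lborel (\<lambda>u::real. 210000 / (1 + u\<^sup>2))"
      using integrable_inverse_1_plus_square
      by (auto simp: set_integrable_def einterval_def divide_inverse)
    show "AE u in lborel. (\<lambda>n. rescaled_integrand (t (n + N)) (n + N) u)
        \<longlonglongrightarrow> complex_of_real (exp (- (pi\<^sup>2 * u\<^sup>2 / 6)))"
      using tendsto_rescaled_integrand[OF t saddle, THEN LIMSEQ_ignore_initial_segment] by simp
    show "AE u in lborel. norm (rescaled_integrand (t (n + N)) (n + N) u) \<le> 210000 / (1 + u\<^sup>2)" for n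
      using norm_rescaled_integrand_le N by simp
  qed (auto simp: borel_measurable_rescaled_integrand)
  then show ?thesis
    unfolding integral_complex_of_real gaussian_integral by (rule LIMSEQ_offset)
qed

text \<open>
  At the saddle point, \<open>p n\<close> equals \<open>exp (n * t) * F t * t powr (3/2) / (2 * pi)\<close> times the integral of the
  rescaled integrand. As \<open>n * t = pi\<^sup>2 / (6 * t)\<close>, the two exponentials combine to
  \<open>exp (pi\<^sup>2 / (3 * t)) = exp (pi * sqrt (2 * n / 3))\<close>, and the remaining factors are a constant times
  \<open>t\<^sup>2 = pi\<^sup>2 / (6 * n)\<close>.
\<close>

theorem theorem4p1:
  shows "(\<lambda>n. real (partition_number n) /
            (1 / (4 * real n * sqrt 3) * exp (pi * sqrt (2 * real n / 3)))) \<longlonglongrightarrow> 1"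
proof -
  \<comment> \<open>The saddle point, where \<open>n = pi\<^sup>2 / (6 * t\<^sup>2)\<close>.\<close>
  define t where "t = (\<lambda>n. pi / sqrt (6 * real n))"
  \<comment> \<open>\<open>J n\<close> is the integral of the rescaled integrand, and \<open>R\<close> is the error of the expansion of \<open>ln (F t)\<close>.\<close>
  define J where "J = (\<lambda>n. 2 * pi * real (partition_number n) * exp (- (real n * t n))
      / (t n * sqrt (t n) * exp (log_partition_gf (t n))))"
  define R where "R = (\<lambda>t. log_partition_gf t - (pi\<^sup>2 / (6 * t) + ln (t / (2 * pi)) / 2))"
  have t_lim: "filterlim t (at_right 0) sequentially"
    unfolding t_def by real_asymp
  have t_pos: "0 < t n" if "n > 0" for n
    using that by (simp add: t_def)
  have saddle: "real n * t n = pi\<^sup>2 / (6 * t n)" if "n > 0" for n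
  proof -
    have "6 * real n * (t n)\<^sup>2 = pi\<^sup>2"
      using that by (simp add: t_def power_divide)
    then show ?thesis
      using t_pos[OF that] by (simp add: field_simps power2_eq_square)
  qed
  have exponent: "pi * sqrt (2 * real n / 3) = 2 * (pi\<^sup>2 / (6 * t n))" if "n > 0" for n
  proof -
    have "sqrt (2 * real n / 3) = sqrt (6 * real n / 3\<^sup>2)"
      by (simp add: power2_eq_square)
    also have "\<dots> = sqrt (6 * real n) / 3"
      unfolding real_sqrt_divide by simp
    finally show ?thesis
      using that by (simp add: t_def power2_eq_square)
  qed
  have "\<forall>\<^sub>F n in sequentially. real n * t n = pi\<^sup>2 / (6 * t n)"
    using eventually_gt_at_top[of 0] by (rule eventually_mono) (rule saddle)
  from tendsto_integral_rescaled_integrand[OF t_lim this]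
  have "(\<lambda>n. \<integral>u. rescaled_integrand (t n) n u \<partial>lborel) \<longlonglongrightarrow> of_real (sqrt (6 / pi))" .
  moreover have "\<forall>\<^sub>F n in sequentially. (\<integral>u. rescaled_integrand (t n) n u \<partial>lborel) = of_real (J n)"
    using eventually_gt_at_top[of 0]
    by (rule eventually_mono) (simp only: J_def integral_rescaled_integrand t_pos)
  ultimately have "(\<lambda>n. complex_of_real (J n)) \<longlonglongrightarrow> of_real (sqrt (6 / pi))"
    by (rule Lim_transform_eventually)
  then have J: "J \<longlonglongrightarrow> sqrt (6 / pi)"
    by (simp only: tendsto_of_real_iff)
  have R: "(\<lambda>n. R (t n)) \<longlonglongrightarrow> 0"
    unfolding R_def using log_partition_gf_asymptotics t_lim by (rule filterlim_compose)
  have lim: "(\<lambda>n. exp (R (t n)) * J n * sqrt (pi / 6)) \<longlonglongrightarrow> exp 0 * sqrt (6 / pi) * sqrt (pi / 6)"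
    by (intro tendsto_intros J R)
  have limit_value: "exp 0 * sqrt (6 / pi) * sqrt (pi / 6) = 1"
    by (simp flip: real_sqrt_mult)
  have eq: "\<forall>\<^sub>F n in sequentially. exp (R (t n)) * J n * sqrt (pi / 6) =
      real (partition_number n) / (1 / (4 * real n * sqrt 3) * exp (pi * sqrt (2 * real n / 3)))"
    using eventually_gt_at_top[of 0]
  proof (rule eventually_mono)
    fix n :: nat assume n: "n > 0"
    define s where "s = t n"
    define X where "X = exp (pi\<^sup>2 / (6 * s))"
    define L where "L = exp (log_partition_gf s)"
    have s: "s > 0" and n_eq: "real n = pi\<^sup>2 / (6 * s\<^sup>2)"
      using t_pos[OF n] saddle[OF n] by (auto simp: s_def field_simps power2_eq_square)
    have "exp (R s) = L / (X * exp (ln (s / (2 * pi)) / 2))"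
      by (simp add: R_def L_def X_def exp_diff exp_add)
    also have "exp (ln (s / (2 * pi)) / 2) = sqrt (s / (2 * pi))"
      using s by (simp add: ln_sqrt[symmetric])
    finally have expR: "exp (R s) = L / (X * sqrt (s / (2 * pi)))" .
    have J_eq: "J n = 2 * pi * real (partition_number n) / (X * s * sqrt s * L)"
      using saddle[OF n] by (simp add: J_def s_def X_def L_def exp_minus field_simps)
    have "L > 0" "X > 0" by (auto simp: L_def X_def)
    \<comment> \<open>The Gaussian constant, written so that the factors \<open>sqrt (2 * pi)\<close> cancel.\<close>
    have root: "sqrt (pi / 6) = 2 * pi * sqrt 3 / (6 * sqrt (2 * pi))"
    proof (rule real_sqrt_unique)
      show "(2 * pi * sqrt 3 / (6 * sqrt (2 * pi)))\<^sup>2 = pi / 6"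
        by (simp add: power_divide power_mult_distrib) (simp add: power2_eq_square)
    qed simp
    have "exp (R s) * J n * sqrt (pi / 6)
        = real (partition_number n) / X\<^sup>2 * (2 * pi * sqrt (pi / 6) / (s * sqrt s * sqrt (s / (2 * pi))))"
      unfolding expR J_eq using \<open>L > 0\<close> \<open>X > 0\<close> s by (simp add: field_simps power2_eq_square)
    also have "2 * pi * sqrt (pi / 6) / (s * sqrt s * sqrt (s / (2 * pi)))
        = 4 * (pi\<^sup>2 / (6 * s\<^sup>2)) * sqrt 3"
      unfolding root using s by (simp add: real_sqrt_divide field_simps power2_eq_square)
    also have "real (partition_number n) / X\<^sup>2 * (4 * (pi\<^sup>2 / (6 * s\<^sup>2)) * sqrt 3)
        = real (partition_number n) / (1 / (4 * real n * sqrt 3) * X\<^sup>2)"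
      unfolding n_eq by simp
    also have "X\<^sup>2 = exp (pi * sqrt (2 * real n / 3))"
      unfolding exponent[OF n] by (simp only: X_def s_def exp_double)
    finally show "exp (R (t n)) * J n * sqrt (pi / 6) =
        real (partition_number n) / (1 / (4 * real n * sqrt 3) * exp (pi * sqrt (2 * real n / 3)))"
      by (simp add: s_def)
  qed
  show ?thesis
    using Lim_transform_eventually[OF lim eq] unfolding limit_value .
qed

end
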